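(* Let $(E,\tau,M,\rho)$ be a Lie algebroid over a smooth manifold $M$. The $\Omega(M,E)$-valued exterior derivative $d_\rho$ has the following properties: 1. For each $V\in A^1(M,E)$, the Lie derivative $\mathcal{L}_\rho(V)$, the exterior derivative $d_\rho$ and the interior product $i(V)$, as endomorphisms of $\Omega(M,E)$, are related by $$\mathcal{L}_\rho(V)=i(V)\circ d_\rho+d_\rho\circ i(V).$$ 2. The exterior derivative $d_\rho$ is a derivation of degree $1$ of the exterior algebra $\Omega(M,E)$, i.e. for each $p\in\mathbb{Z}$, $\eta\in\Omega^p(M,E)$ and $\zeta\in\Omega(M,E)$, $$d_\rho(\eta\wedge\zeta)=d_\rho\eta\wedge\zeta+(-1)^p\eta\wedge d_\rho\zeta.$$ 3. For each $V\in A^1(M,E)$, $$\mathcal{L}_\rho(V)\circ d_\rho=d_\rho\circ\mathcal{L}_\rho(V).$$ 4. The square of $d_\rho$ vanishes identically: $d_\rho\circ d_\rho=0$.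
   Context: A Lie algebroid $(E,\tau,M,\rho)$ is a smooth real vector bundle $(E,\tau,M)$ of finite rank over a smooth manifold $M$ (with projection $\tau:E\to M$), equipped with a Lie algebra bracket $(s_1,s_2)\mapsto\{s_1,s_2\}$ on the space of smooth sections of $\tau$ and a smooth vector bundle map $\rho:E\to TM$ (the anchor), such that $s\mapsto\rho\circ s$ is a Lie algebra homomorphism into the Lie algebra of smooth vector fields on $M$, and $\{s_1,fs_2\}=f\{s_1,s_2\}+\langle df,\rho\circ s_1\rangle s_2$ for all smooth sections $s_1,s_2$ and all $f\in C^\infty(M,\mathbb{R})$. For $p\in\mathbb{Z}$, $A^p(M,E)$ is the space of smooth sections of $\bigwedge^pE$ and $\Omega^p(M,E)$ the space of smooth sections of $\bigwedge^pE^*$, with degree-$0$ parts equal to $C^\infty(M,\mathbb{R})$ and zero for $p<0$; $\Omega(M,E)=\oplus_p\Omega^p(M,E)$ is a graded algebra for the exterior product. An element of $\Omega^p(M,E)$ is identified with a skew-symmetric $C^\infty(M,\mathbb{R})$-multilinear map $A^1(M,E)^p\to C^\infty(M,\mathbb{R})$; the exterior product of forms of degrees $p,q$ is the sum over $(p,q)$-shuffles $\sigma$ of $\varepsilon(\sigma)\,\xi(V_{\sigma(1)},\ldots,V_{\sigma(p)})\,\eta(V_{\sigma(p+1)},\ldots,V_{\sigma(p+q)})$. For $V\in A^1(M,E)$ and $\eta\in\Omega^p(M,E)$, $i(V)\eta=0$ if $p\le0$ and $i(V)\eta(V_1,\ldots,V_{p-1})=\eta(V,V_1,\ldots,V_{p-1})$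 if $p\ge1$. For $V\in A^1(M,E)$, $\mathcal{L}_\rho(V):\Omega(M,E)\to\Omega(M,E)$ is the $\mathbb{R}$-linear, degree $0$ map with $\mathcal{L}_\rho(V)f=\langle df,\rho\circ V\rangle$ for functions $f$ and, for $\eta\in\Omega^p(M,E)$, $p>0$, $(\mathcal{L}_\rho(V)\eta)(V_1,\ldots,V_p)=\mathcal{L}_\rho(V)(\eta(V_1,\ldots,V_p))-\sum_{i=1}^p\eta(V_1,\ldots,\{V,V_i\},\ldots,V_p)$. $d_\rho:\Omega(M,E)\to\Omega(M,E)$ is the $\mathbb{R}$-linear, degree $1$ map with $\langle d_\rho f,V\rangle=\langle df,\rho\circ V\rangle$ for functions $f$ and, for $\eta\in\Omega^p(M,E)$, $p\ge1$, $d_\rho\eta(V_0,\ldots,V_p)=\sum_{i=0}^p(-1)^i\mathcal{L}_\rho(V_i)(\eta(V_0,\ldots,\widehat{V}_i,\ldots,V_p))+\sum_{0\le i<j\le p}(-1)^{i+j}\eta(\{V_i,V_j\},V_0,\ldots,\widehat{V}_i,\ldots,\widehat{V}_j,\ldots,V_p)$ (hats denote omitted terms). *)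

theory Defs
  imports "HOL-Analysis.Analysis" "HOL-Combinatorics.Permutations"
begin

section \<open>Smooth manifolds\<close>

text \<open>
  Model spaces (for manifolds and for fibres of bundles) are finite-dimensional real normed spaces.
  Unlike the class of Euclidean spaces, this allows dimension 0: manifolds that are discrete, and
  bundles of rank 0.
\<close>

definition finite_dim :: "'b::real_normed_vector itself \<Rightarrow> bool" where
  "finite_dim _ \<longleftrightarrow> (\<exists>B::'b set. finite B \<and> span B = UNIV)"

text \<open>
  Class \<open>C\<^sup>k\<close> and \<open>C\<^sup>\<infinity>\<close> on an open subset of a finite-dimensional space. As the directions \<open>v\<close> are
  fixed before differentiating again, no space of linear maps is needed.
\<close>

primrec C_k_on ::
  "nat \<Rightarrow> 'b::real_normed_vector set \<Rightarrow> ('b \<Rightarrow> 'c::real_normed_vector) \<Rightarrow> bool" where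
  "C_k_on 0 S f \<longleftrightarrow> continuous_on S f"
| "C_k_on (Suc k) S f \<longleftrightarrow> (\<forall>x\<in>S. f differentiable (at x)) \<and>
     (\<forall>v. C_k_on k S (\<lambda>x. frechet_derivative f (at x) v))"

definition smooth_on :: "'b::real_normed_vector set \<Rightarrow> ('b \<Rightarrow> 'c::real_normed_vector) \<Rightarrow> bool" where
  "smooth_on S f \<longleftrightarrow> (\<forall>k. C_k_on k S f)"

text \<open>
  The manifold is the whole type \<open>'m\<close>; its smooth structure is given by an atlas, which need not be
  maximal. A chart is a pair of a domain and a coordinate map.
\<close>

type_synonym ('m, 'b) atlas = "('m set \<times> ('m \<Rightarrow> 'b)) set"

definition smooth_manifold ::
  "('m::{t2_space,second_countable_topology}, 'b::real_normed_vector) atlas \<Rightarrow> bool" where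
  "smooth_manifold A \<longleftrightarrow>
     finite_dim TYPE('b) \<and>
     (\<Union>(U, \<phi>)\<in>A. U) = UNIV \<and>
     (\<forall>(U, \<phi>)\<in>A. open U \<and> open (\<phi> ` U) \<and> homeomorphism U (\<phi> ` U) \<phi> (inv_into U \<phi>)) \<and>
     (\<forall>(U, \<phi>)\<in>A. \<forall>(V, \<psi>)\<in>A. smooth_on (\<phi> ` (U \<inter> V)) (\<psi> \<circ> inv_into U \<phi>))"

definition smooth_map_on ::
  "('m::topological_space, 'b::real_normed_vector) atlas \<Rightarrow> 'm set
    \<Rightarrow> ('m \<Rightarrow> 'c::real_normed_vector) \<Rightarrow> bool" where
  "smooth_map_on A W f \<longleftrightarrow> (\<forall>(U, \<phi>)\<in>A. smooth_on (\<phi> ` (U \<inter> W)) (f \<circ> inv_into U \<phi>))"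

definition smooth_functions ::
  "('m::topological_space, 'b::real_normed_vector) atlas \<Rightarrow> ('m \<Rightarrow> real) set" where
  "smooth_functions A = {f. smooth_map_on A UNIV f}"

section \<open>Smooth vector bundles\<close>

text \<open>
  A bundle chart \<open>(U, \<beta>)\<close> is (the inverse of) a local trivialization over \<open>U\<close>: \<open>\<beta> x\<close> is a linear
  isomorphism from the model fibre \<open>'f\<close> onto the fibre over \<open>x\<close>. The total space carries the unique
  smooth structure making all maps \<open>(x, v) \<mapsto> \<beta> x v\<close> diffeomorphisms onto the preimages of their
  domains; it exists by the smoothness of the transition maps.
\<close>

record ('m, 'e, 'f) vbundle =
  vb_total :: "'e set"
  vb_proj :: "'e \<Rightarrow> 'm"
  vb_add :: "'e \<Rightarrow> 'e \<Rightarrow> 'e"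
  vb_scale :: "real \<Rightarrow> 'e \<Rightarrow> 'e"
  vb_zero :: "'m \<Rightarrow> 'e"
  vb_charts :: "('m set \<times> ('m \<Rightarrow> 'f \<Rightarrow> 'e)) set"

definition fibre :: "('m, 'e, 'f) vbundle \<Rightarrow> 'm \<Rightarrow> 'e set" where
  "fibre E x = {e \<in> vb_total E. vb_proj E e = x}"

definition smooth_vector_bundle ::
  "('m::{t2_space,second_countable_topology}, 'b::real_normed_vector) atlas
    \<Rightarrow> ('m, 'e, 'f::real_normed_vector) vbundle \<Rightarrow> bool" where
  "smooth_vector_bundle A E \<longleftrightarrow>
     finite_dim TYPE('f) \<and>
     (\<Union>(U, \<beta>)\<in>vb_charts E. U) = UNIV \<and>
     (\<forall>(U, \<beta>)\<in>vb_charts E. open U \<and>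
        (\<forall>x\<in>U. bij_betw (\<beta> x) UNIV (fibre E x) \<and>
           (\<forall>u v. \<beta> x (u + v) = vb_add E (\<beta> x u) (\<beta> x v)) \<and>
           (\<forall>c v. \<beta> x (c *\<^sub>R v) = vb_scale E c (\<beta> x v)) \<and>
           \<beta> x 0 = vb_zero E x)) \<and>
     (\<forall>(U, \<beta>)\<in>vb_charts E. \<forall>(U', \<beta>')\<in>vb_charts E. \<forall>v.
        \<exists>a. smooth_map_on A (U \<inter> U') a \<and> (\<forall>x\<in>U \<inter> U'. \<beta> x v = \<beta>' x (a x)))"

definition smooth_sections ::
  "('m::topological_space, 'b::real_normed_vector) atlas
    \<Rightarrow> ('m, 'e, 'f::real_normed_vector) vbundle \<Rightarrow> ('m \<Rightarrow> 'e) set" where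
  "smooth_sections A E =
     {s. (\<forall>x. s x \<in> fibre E x) \<and>
         (\<forall>(U, \<beta>)\<in>vb_charts E. \<exists>a. smooth_map_on A U a \<and> (\<forall>x\<in>U. s x = \<beta> x (a x)))}"

definition sec_add :: "('m, 'e, 'f) vbundle \<Rightarrow> ('m \<Rightarrow> 'e) \<Rightarrow> ('m \<Rightarrow> 'e) \<Rightarrow> 'm \<Rightarrow> 'e" where
  "sec_add E s t = (\<lambda>x. vb_add E (s x) (t x))"

definition sec_scale :: "('m, 'e, 'f) vbundle \<Rightarrow> ('m \<Rightarrow> real) \<Rightarrow> ('m \<Rightarrow> 'e) \<Rightarrow> 'm \<Rightarrow> 'e" where
  "sec_scale E f s = (\<lambda>x. vb_scale E (f x) (s x))"

text \<open>
  Smooth vector bundle maps over the identity of the base; the last clause says that in local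
  trivializations the map is given by a smooth family of linear maps.
\<close>

definition smooth_bundle_map ::
  "('m::topological_space, 'b::real_normed_vector) atlas
    \<Rightarrow> ('m, 'e, 'f::real_normed_vector) vbundle
    \<Rightarrow> ('m, 'd, 'g::real_normed_vector) vbundle \<Rightarrow> ('e \<Rightarrow> 'd) \<Rightarrow> bool" where
  "smooth_bundle_map A E F \<Phi> \<longleftrightarrow>
     (\<forall>x. \<forall>e\<in>fibre E x. \<Phi> e \<in> fibre F x) \<and>
     (\<forall>x. \<forall>e\<in>fibre E x. \<forall>e'\<in>fibre E x. \<Phi> (vb_add E e e') = vb_add F (\<Phi> e) (\<Phi> e')) \<and>
     (\<forall>c. \<forall>e\<in>vb_total E. \<Phi> (vb_scale E c e) = vb_scale F c (\<Phi> e)) \<and>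
     (\<forall>(U, \<beta>)\<in>vb_charts E. \<forall>(U', \<beta>')\<in>vb_charts F. \<forall>v.
        \<exists>a. smooth_map_on A (U \<inter> U') a \<and> (\<forall>x\<in>U \<inter> U'. \<Phi> (\<beta> x v) = \<beta>' x (a x)))"

section \<open>The tangent bundle\<close>

text \<open>
  Tangent vectors at \<open>x\<close> are derivations at \<open>x\<close> of the algebra of smooth functions. They are set to 0
  on functions that are not smooth, so that equality of tangent vectors is equality of functions.
\<close>

definition tangent_space ::
  "('m::topological_space, 'b::real_normed_vector) atlas \<Rightarrow> 'm \<Rightarrow> (('m \<Rightarrow> real) \<Rightarrow> real) set" where
  "tangent_space A x =
     {v. (\<forall>f\<in>smooth_functions A. \<forall>g\<in>smooth_functions A. v (\<lambda>y. f y + g y) = v f + v g) \<and>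
         (\<forall>c. \<forall>f\<in>smooth_functions A. v (\<lambda>y. c * f y) = c * v f) \<and>
         (\<forall>f\<in>smooth_functions A. \<forall>g\<in>smooth_functions A.
            v (\<lambda>y. f y * g y) = f x * v g + g x * v f) \<and>
         (\<forall>f. f \<notin> smooth_functions A \<longrightarrow> v f = 0)}"

text \<open>The coordinate vector field of a chart with constant components \<open>w\<close>.\<close>

definition coord_vector ::
  "('m::topological_space, 'b::real_normed_vector) atlas \<Rightarrow> 'm set \<Rightarrow> ('m \<Rightarrow> 'b) \<Rightarrow> 'm \<Rightarrow> 'b
    \<Rightarrow> ('m \<Rightarrow> real) \<Rightarrow> real" where
  "coord_vector A U \<phi> x w =
     (\<lambda>f. if f \<in> smooth_functions A
          then frechet_derivative (f \<circ> inv_into U \<phi>) (at (\<phi> x)) w else 0)"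

type_synonym 'm tangent = "'m \<times> (('m \<Rightarrow> real) \<Rightarrow> real)"

definition tangent_bundle ::
  "('m::topological_space, 'b::real_normed_vector) atlas \<Rightarrow> ('m, 'm tangent, 'b) vbundle" where
  "tangent_bundle A =
     \<lparr>vb_total = {(x, v). v \<in> tangent_space A x},
      vb_proj = fst,
      vb_add = (\<lambda>(x, v) (y, w). (x, \<lambda>f. v f + w f)),
      vb_scale = (\<lambda>c (x, v). (x, \<lambda>f. c * v f)),
      vb_zero = (\<lambda>x. (x, \<lambda>f. 0)),
      vb_charts = (\<lambda>(U, \<phi>). (U, \<lambda>x w. (x, coord_vector A U \<phi> x w))) ` A\<rparr>"

text \<open>The function \<open>\<langle>df, X\<rangle>\<close> for a vector field \<open>X\<close>.\<close>

definition vf_apply :: "('m \<Rightarrow> 'm tangent) \<Rightarrow> ('m \<Rightarrow> real) \<Rightarrow> 'm \<Rightarrow> real" where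
  "vf_apply X f = (\<lambda>x. snd (X x) f)"

definition vf_bracket ::
  "('m::topological_space, 'b::real_normed_vector) atlas
    \<Rightarrow> ('m \<Rightarrow> 'm tangent) \<Rightarrow> ('m \<Rightarrow> 'm tangent) \<Rightarrow> 'm \<Rightarrow> 'm tangent" where
  "vf_bracket A X Y =
     (\<lambda>x. (x, \<lambda>f. if f \<in> smooth_functions A
                  then vf_apply X (vf_apply Y f) x - vf_apply Y (vf_apply X f) x else 0))"

section \<open>Lie algebroids\<close>

definition lie_algebra_on_sections ::
  "('m::topological_space, 'b::real_normed_vector) atlas
    \<Rightarrow> ('m, 'e, 'f::real_normed_vector) vbundle
    \<Rightarrow> (('m \<Rightarrow> 'e) \<Rightarrow> ('m \<Rightarrow> 'e) \<Rightarrow> 'm \<Rightarrow> 'e) \<Rightarrow> bool" where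
  "lie_algebra_on_sections A E br \<longleftrightarrow>
     (let S = smooth_sections A E in
     (\<forall>s\<in>S. \<forall>t\<in>S. br s t \<in> S) \<and>
     (\<forall>s\<in>S. \<forall>t\<in>S. \<forall>u\<in>S. br (sec_add E s t) u = sec_add E (br s u) (br t u)) \<and>
     (\<forall>s\<in>S. \<forall>t\<in>S. \<forall>u\<in>S. br s (sec_add E t u) = sec_add E (br s t) (br s u)) \<and>
     (\<forall>c. \<forall>s\<in>S. \<forall>t\<in>S. br (sec_scale E (\<lambda>_. c) s) t = sec_scale E (\<lambda>_. c) (br s t)) \<and>
     (\<forall>c. \<forall>s\<in>S. \<forall>t\<in>S. br s (sec_scale E (\<lambda>_. c) t) = sec_scale E (\<lambda>_. c) (br s t)) \<and>
     (\<forall>s\<in>S. br s s = vb_zero E) \<and>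
     (\<forall>s\<in>S. \<forall>t\<in>S. \<forall>u\<in>S.
        sec_add E (br s (br t u)) (sec_add E (br t (br u s)) (br u (br s t))) = vb_zero E))"

text \<open>
  The map \<open>s \<mapsto> \<rho> \<circ> s\<close> is \<open>\<real>\<close>-linear into the smooth vector fields because \<open>\<rho>\<close> is a smooth bundle
  map, so that being a Lie algebra homomorphism amounts to preserving brackets.
\<close>

definition lie_algebroid ::
  "('m::{t2_space,second_countable_topology}, 'b::real_normed_vector) atlas
    \<Rightarrow> ('m, 'e, 'f::real_normed_vector) vbundle
    \<Rightarrow> (('m \<Rightarrow> 'e) \<Rightarrow> ('m \<Rightarrow> 'e) \<Rightarrow> 'm \<Rightarrow> 'e) \<Rightarrow> ('e \<Rightarrow> 'm tangent) \<Rightarrow> bool" where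
  "lie_algebroid A E br \<rho> \<longleftrightarrow>
     smooth_manifold A \<and>
     smooth_vector_bundle A E \<and>
     lie_algebra_on_sections A E br \<and>
     smooth_bundle_map A E (tangent_bundle A) \<rho> \<and>
     (\<forall>s\<in>smooth_sections A E. \<forall>t\<in>smooth_sections A E.
        \<rho> \<circ> br s t = vf_bracket A (\<rho> \<circ> s) (\<rho> \<circ> t)) \<and>
     (\<forall>s\<in>smooth_sections A E. \<forall>t\<in>smooth_sections A E. \<forall>f\<in>smooth_functions A.
        br s (sec_scale E f t) =
          sec_add E (sec_scale E f (br s t)) (sec_scale E (vf_apply (\<rho> \<circ> s) f) t))"

section \<open>Forms\<close>

text \<open>
  A form of degree \<open>p\<close>, that is, a smooth section of the \<open>p\<close>-th exterior power of the dual bundle, is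
  identified with a skew-symmetric \<open>C\<^sup>\<infinity>\<close>-multilinear map on \<open>p\<close>-tuples of smooth sections, with
  smooth functions as values. Tuples are lists, and a form is extended by 0 to all lists which
  are not \<open>p\<close>-tuples of smooth sections. Hence a form of degree 0 is a smooth function, namely its
  value at the empty list, and only 0 has negative degree. A family of forms of all degrees is a
  single function on lists, whose component in degree \<open>p\<close> is its restriction to lists of length \<open>p\<close>;
  addition in the direct sum is pointwise.
\<close>

type_synonym ('m, 'e) form = "('m \<Rightarrow> 'e) list \<Rightarrow> 'm \<Rightarrow> real"

definition forms_deg ::
  "('m::topological_space, 'b::real_normed_vector) atlas
    \<Rightarrow> ('m, 'e, 'f::real_normed_vector) vbundle \<Rightarrow> int \<Rightarrow> ('m, 'e) form set" where
  "forms_deg A E p =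
     {\<omega>. let S = smooth_sections A E in
       (\<forall>Vs. \<not> (int (length Vs) = p \<and> set Vs \<subseteq> S) \<longrightarrow> \<omega> Vs = (\<lambda>x. 0)) \<and>
       (\<forall>Vs. \<omega> Vs \<in> smooth_functions A) \<and>
       (\<forall>Vs. \<forall>i<length Vs. set Vs \<subseteq> S \<longrightarrow> (\<forall>s\<in>S. \<forall>t\<in>S.
          \<omega> (Vs[i := sec_add E s t]) = (\<lambda>x. \<omega> (Vs[i := s]) x + \<omega> (Vs[i := t]) x))) \<and>
       (\<forall>Vs. \<forall>i<length Vs. set Vs \<subseteq> S \<longrightarrow> (\<forall>f\<in>smooth_functions A. \<forall>s\<in>S.
          \<omega> (Vs[i := sec_scale E f s]) = (\<lambda>x. f x * \<omega> (Vs[i := s]) x))) \<and>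
       (\<forall>Vs. \<forall>i<length Vs. \<forall>j<length Vs. i \<noteq> j \<longrightarrow>
          \<omega> (Vs[i := Vs ! j, j := Vs ! i]) = (\<lambda>x. - \<omega> Vs x))}"

definition deg_part :: "int \<Rightarrow> ('m, 'e) form \<Rightarrow> ('m, 'e) form" where
  "deg_part p \<omega> = (\<lambda>Vs x. if int (length Vs) = p then \<omega> Vs x else 0)"

definition forms ::
  "('m::topological_space, 'b::real_normed_vector) atlas
    \<Rightarrow> ('m, 'e, 'f::real_normed_vector) vbundle \<Rightarrow> ('m, 'e) form set" where
  "forms A E =
     {\<omega>. (\<forall>p. deg_part p \<omega> \<in> forms_deg A E p) \<and> finite {p. deg_part p \<omega> \<noteq> (\<lambda>Vs x. 0)}}"

definition form_add :: "('m, 'e) form \<Rightarrow> ('m, 'e) form \<Rightarrow> ('m, 'e) form" where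
  "form_add \<eta> \<zeta> = (\<lambda>Vs x. \<eta> Vs x + \<zeta> Vs x)"

definition form_scale :: "real \<Rightarrow> ('m, 'e) form \<Rightarrow> ('m, 'e) form" where
  "form_scale c \<eta> = (\<lambda>Vs x. c * \<eta> Vs x)"

definition form_zero :: "('m, 'e) form" where
  "form_zero = (\<lambda>Vs x. 0)"

text \<open>Shuffles of \<open>{0..<n}\<close> into a block of length \<open>p\<close> and one of length \<open>n - p\<close>.\<close>

definition shuffle_perms :: "nat \<Rightarrow> nat \<Rightarrow> (nat \<Rightarrow> nat) set" where
  "shuffle_perms p n =
     {\<sigma>. \<sigma> permutes {..<n} \<and> strict_mono_on {..<p} \<sigma> \<and> strict_mono_on {p..<n} \<sigma>}"

text \<open>
  For \<open>\<eta>\<close> of degree \<open>q\<close> only the summand \<open>p = q\<close> is nonzero; the sum over \<open>p\<close> extends the product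
  bilinearly to forms which are not homogeneous.
\<close>

definition wedge :: "('m, 'e) form \<Rightarrow> ('m, 'e) form \<Rightarrow> ('m, 'e) form" where
  "wedge \<eta> \<zeta> = (\<lambda>Vs x. let n = length Vs in
     \<Sum>p\<le>n. \<Sum>\<sigma>\<in>shuffle_perms p n. of_int (sign \<sigma>) *
        \<eta> (map (\<lambda>i. Vs ! \<sigma> i) [0..<p]) x * \<zeta> (map (\<lambda>i. Vs ! \<sigma> i) [p..<n]) x)"

section \<open>Interior product, Lie derivative and exterior derivative\<close>

definition interior_product :: "('m \<Rightarrow> 'e) \<Rightarrow> ('m, 'e) form \<Rightarrow> ('m, 'e) form" where
  "interior_product V \<eta> = (\<lambda>Vs. \<eta> (V # Vs))"

text \<open>
  In the next two definitions the case of functions is not separate: for the Lie derivative it is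
  the empty list, where the sum is empty, and for the exterior derivative it is the list of length 1,
  where only the summand for \<open>i = 0\<close> is present.
\<close>

definition lie_derivative ::
  "('m::topological_space, 'b::real_normed_vector) atlas
    \<Rightarrow> ('m, 'e, 'f::real_normed_vector) vbundle
    \<Rightarrow> (('m \<Rightarrow> 'e) \<Rightarrow> ('m \<Rightarrow> 'e) \<Rightarrow> 'm \<Rightarrow> 'e) \<Rightarrow> ('e \<Rightarrow> 'm tangent)
    \<Rightarrow> ('m \<Rightarrow> 'e) \<Rightarrow> ('m, 'e) form \<Rightarrow> ('m, 'e) form" where
  "lie_derivative A E br \<rho> V \<eta> = (\<lambda>Vs x.
     if set Vs \<subseteq> smooth_sections A E
     then vf_apply (\<rho> \<circ> V) (\<eta> Vs) x - (\<Sum>i<length Vs. \<eta> (Vs[i := br V (Vs ! i)]) x)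
     else 0)"

definition omit :: "nat \<Rightarrow> 'a list \<Rightarrow> 'a list" where
  "omit i xs = take i xs @ drop (Suc i) xs"

definition ext_derivative ::
  "('m::topological_space, 'b::real_normed_vector) atlas
    \<Rightarrow> ('m, 'e, 'f::real_normed_vector) vbundle
    \<Rightarrow> (('m \<Rightarrow> 'e) \<Rightarrow> ('m \<Rightarrow> 'e) \<Rightarrow> 'm \<Rightarrow> 'e) \<Rightarrow> ('e \<Rightarrow> 'm tangent)
    \<Rightarrow> ('m, 'e) form \<Rightarrow> ('m, 'e) form" where
  "ext_derivative A E br \<rho> \<eta> = (\<lambda>Vs x.
     if set Vs \<subseteq> smooth_sections A E
     then (\<Sum>i<length Vs. (-1) ^ i * vf_apply (\<rho> \<circ> Vs ! i) (\<eta> (omit i Vs)) x) +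
          (\<Sum>j<length Vs. \<Sum>i<j. (-1) ^ (i + j) *
             \<eta> (br (Vs ! i) (Vs ! j) # omit i (omit j Vs)) x)
     else 0)"

definition form_endomorphism ::
  "('m::topological_space, 'b::real_normed_vector) atlas
    \<Rightarrow> ('m, 'e, 'f::real_normed_vector) vbundle
    \<Rightarrow> (('m, 'e) form \<Rightarrow> ('m, 'e) form) \<Rightarrow> bool" where
  "form_endomorphism A E D \<longleftrightarrow>
     (\<forall>\<eta>\<in>forms A E. D \<eta> \<in> forms A E) \<and>
     (\<forall>\<eta>\<in>forms A E. \<forall>\<zeta>\<in>forms A E. D (form_add \<eta> \<zeta>) = form_add (D \<eta>) (D \<zeta>)) \<and>
     (\<forall>c. \<forall>\<eta>\<in>forms A E. D (form_scale c \<eta>) = form_scale c (D \<eta>))"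

end

theory Submission
  imports Defs
begin

text \<open>
  A form is determined by its value on the empty list and by its contractions with sections, so every
  identity between operators on forms can be proved by induction on the list of arguments, once the
  commutators of the operators with the contractions \<open>i(V)\<close> are known. Only Cartan's formula
  \<open>i(V) d = L(V) - d i(V)\<close>, the relation \<open>[L(V), i(W)] = i({V, W})\<close> and the antiderivation
  rule for \<open>i(V)\<close>, which is a decomposition of shuffles according to the position of the
  first argument, are computed from the definitions. The induction then yields in turn
  \<open>[L(V), L(W)] = L({V, W})\<close> (by the Jacobi identity), \<open>[L(V), d] = 0\<close>,
  \<open>d d = 0\<close>, the derivation rules for \<open>L(V)\<close> and \<open>d\<close>, and that \<open>L(V)\<close>, \<open>d\<close> and
  the exterior product preserve multilinearity and skew-symmetry.

  Smoothness of the values reduces to smoothness of the derivative of a smooth function along an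
  anchored section, which is read off in charts; there the coordinates of the finite-dimensional
  model spaces have to be known to be continuous.
\<close>

section \<open>Finite-dimensional normed spaces\<close>

text \<open>The induction replaces a form by its contractions, so the class of forms must be closed
  under contraction, both derivatives and the product without reference to degree. Hence the
  predicate \<open>alt_form\<close>, and hence the sign \<open>(-1) ^ p\<close> as an operator
  \<open>form_hat\<close> instead of a scalar; degrees return only through
  \<open>forms_deg_iff\<close> and \<open>forms_iff\<close>. A commutation rule applies only to
  something already known to be an \<open>alt_form\<close>, so closure precedes each identity. The
  delicate closure is that of \<open>ext_derivative\<close>: linearity over functions in the first
  argument cannot be read off Cartan's formula, because L(fV) differs from f L(V). It is derived
  from skew-symmetry instead. The operations on fibres are known only through bundle charts.
  Identities between sections are therefore transported from the model fibre or evaluated inside a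
  form, where they become identities of real numbers. A model space is a normed space with a finite
  spanning set and no preferred coordinates, so their continuity has to be proved.\<close>

lemma finite_independent_coords_bounded:
  fixes B :: "'b::real_normed_vector set"
  assumes "finite B" "independent B"
  shows "\<exists>K\<ge>0. \<forall>c. \<forall>b\<in>B. \<bar>c b\<bar> \<le> K * norm (\<Sum>b\<in>B. c b *\<^sub>R b)"
  using assms
proof (induction B)
  case empty
  then show ?case by auto
next
  case (insert x B)
  then have xB: "x \<notin> span B" and "independent B"
    by (auto simp: independent_insert)
  with insert.IH obtain K where "K \<ge> 0"
    and K: "\<And>c b. b \<in> B \<Longrightarrow> \<bar>c b\<bar> \<le> K * norm (\<Sum>b\<in>B. c b *\<^sub>R b)"
    by blast
  \<comment> \<open>\<open>span B\<close> is closed: if elements of it converged to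
    \<open>x\<close>, the induction hypothesis applied to their differences would make each
    coordinate a Cauchy sequence, and the limits would express \<open>x\<close> through
    \<open>B\<close>.\<close>
  have "\<exists>\<delta>>0. \<forall>s\<in>span B. \<delta> \<le> norm (x - s)"
  proof (rule ccontr)
    assume "\<not> ?thesis"
    then have "\<exists>s. s \<in> span B \<and> norm (x - s) < inverse (real (Suc n))" for n
      by (metis not_le inverse_positive_iff_positive of_nat_0_less_iff zero_less_Suc)
    then obtain s where sB: "\<And>n. s n \<in> span B"
      and sx: "\<And>n. norm (x - s n) < inverse (real (Suc n))"
      by metis
    have "(\<lambda>n. norm (s n - x)) \<longlonglongrightarrow> 0"
      by (rule tendsto_sandwich[OF _ _ tendsto_const LIMSEQ_inverse_real_of_nat])
        (auto simp: norm_minus_commute intro!: always_eventually less_imp_le[OF sx[unfolded of_nat_Suc]])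
    then have lim: "s \<longlonglongrightarrow> x"
      by (simp add: LIM_zero_iff tendsto_norm_zero_iff)
    then have "Cauchy s"
      by (rule LIMSEQ_imp_Cauchy)
    have "\<forall>n. \<exists>c. s n = (\<Sum>b\<in>B. c b *\<^sub>R b)"
      using sB span_finite[OF insert.hyps(1)] by auto
    then obtain c where c: "\<And>n. s n = (\<Sum>b\<in>B. c n b *\<^sub>R b)"
      by metis
    have "\<exists>l. (\<lambda>n. c n b) \<longlonglongrightarrow> l" if "b \<in> B" for b
    proof -
      have "Cauchy (\<lambda>n. c n b)"
      proof (rule metric_CauchyI)
        fix e :: real assume "e > 0"
        \<comment> \<open>Dividing by \<open>K + 1\<close> covers the case
          \<open>K = 0\<close>.\<close>
        then have "e / (K + 1) > 0"
          using \<open>K \<ge> 0\<close> by simp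
        then obtain N where N: "\<And>m n. m \<ge> N \<Longrightarrow> n \<ge> N \<Longrightarrow> dist (s m) (s n) < e / (K + 1)"
          using metric_CauchyD[OF \<open>Cauchy s\<close>] by meson
        have "dist (c m b) (c n b) < e" if "m \<ge> N" "n \<ge> N" for m n
        proof -
          have "\<bar>c m b - c n b\<bar> \<le> K * norm (\<Sum>b\<in>B. (c m b - c n b) *\<^sub>R b)"
            using K[OF \<open>b \<in> B\<close>, of "\<lambda>b. c m b - c n b"] .
          also have "(\<Sum>b\<in>B. (c m b - c n b) *\<^sub>R b) = s m - s n"
            by (simp add: c scaleR_diff_left sum_subtractf)
          also have "K * norm (s m - s n) \<le> (K + 1) * norm (s m - s n)"
            by (simp add: mult_right_mono)
          also have "\<dots> < e"
            using N[OF that] \<open>K \<ge> 0\<close> by (simp add: dist_norm field_simps)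
          finally show ?thesis
            by (simp add: dist_real_def)
        qed
        then show "\<exists>N. \<forall>m\<ge>N. \<forall>n\<ge>N. dist (c m b) (c n b) < e"
          by blast
      qed
      then show ?thesis
        using real_Cauchy_convergent convergent_def by blast
    qed
    then obtain l where "\<And>b. b \<in> B \<Longrightarrow> (\<lambda>n. c n b) \<longlonglongrightarrow> l b"
      by metis
    then have "s \<longlonglongrightarrow> (\<Sum>b\<in>B. l b *\<^sub>R b)"
      unfolding c by (intro tendsto_sum tendsto_scaleR tendsto_const)
    with lim have "x = (\<Sum>b\<in>B. l b *\<^sub>R b)"
      by (rule LIMSEQ_unique)
    then have "x \<in> span B"
      by (simp add: span_base span_scale span_sum)
    with xB show False by simp
  qed
  then obtain \<delta> where "\<delta> > 0" and \<delta>: "\<And>s. s \<in> span B \<Longrightarrow> \<delta> \<le> norm (x - s)"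
    by blast
  \<comment> \<open>The first summand bounds the coordinate at \<open>x\<close> through the distance
    \<delta>. The second bounds the others: the induction hypothesis applies to the vector minus its
    \<open>x\<close>-part, whose norm is at most \<open>1 + norm x / \<delta>\<close> times the norm
    of the vector.\<close>
  define K' where "K' = 1 / \<delta> + K * (1 + norm x / \<delta>)"
  have "K' \<ge> 0"
    using \<open>\<delta> > 0\<close> \<open>K \<ge> 0\<close> by (simp add: K'_def)
  moreover have "\<bar>c b\<bar> \<le> K' * norm (\<Sum>b\<in>insert x B. c b *\<^sub>R b)" if "b \<in> insert x B" for c b
  proof -
    define t where "t = (\<Sum>b\<in>B. c b *\<^sub>R b)"
    have tB: "t \<in> span B"
      unfolding t_def by (simp add: span_base span_scale span_sum)
    define v where "v = c x *\<^sub>R x + t"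
    have v: "(\<Sum>b\<in>insert x B. c b *\<^sub>R b) = v"
      using insert.hyps by (simp add: v_def t_def)
    have cx: "\<bar>c x\<bar> * \<delta> \<le> norm v"
    proof (cases "c x = 0")
      case False
      have "\<delta> \<le> norm (x - (- inverse (c x)) *\<^sub>R t)"
        using tB by (intro \<delta> span_scale)
      then have "\<bar>c x\<bar> * \<delta> \<le> \<bar>c x\<bar> * norm (x - (- inverse (c x)) *\<^sub>R t)"
        by (simp add: mult_left_mono)
      also have "\<dots> = norm (c x *\<^sub>R (x - (- inverse (c x)) *\<^sub>R t))"
        by simp
      also have "c x *\<^sub>R (x - (- inverse (c x)) *\<^sub>R t) = v"
        using False by (simp add: v_def algebra_simps)
      finally show ?thesis .
    qed simp
    then have cx': "\<bar>c x\<bar> \<le> norm v / \<delta>"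
      using \<open>\<delta> > 0\<close> by (simp add: field_simps)
    have K0: "0 \<le> K * (1 + norm x / \<delta>)" and d0: "0 \<le> 1 / \<delta>"
      using \<open>\<delta> > 0\<close> \<open>K \<ge> 0\<close> by auto
    show ?thesis
    proof (cases "b = x")
      case True
      have "\<bar>c x\<bar> \<le> (1 / \<delta>) * norm v"
        using cx' by simp
      also have "\<dots> \<le> K' * norm v"
        using K0 by (intro mult_right_mono) (auto simp: K'_def)
      finally show ?thesis
        using True v by simp
    next
      case False
      have "norm t = norm (v - c x *\<^sub>R x)"
        by (simp add: v_def)
      also have "\<dots> \<le> norm v + \<bar>c x\<bar> * norm x"
        by (metis norm_scaleR norm_triangle_ineq4)
      also have "\<dots> \<le> norm v + norm v / \<delta> * norm x"
        using mult_right_mono[OF cx', of "norm x"] by simp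
      also have "\<dots> = (1 + norm x / \<delta>) * norm v"
        by (simp add: algebra_simps)
      finally have nt: "norm t \<le> (1 + norm x / \<delta>) * norm v" .
      have "\<bar>c b\<bar> \<le> K * norm t"
        using K False that by (simp add: t_def)
      also have "\<dots> \<le> K * ((1 + norm x / \<delta>) * norm v)"
        using nt \<open>K \<ge> 0\<close> by (rule mult_left_mono)
      also have "\<dots> \<le> K' * norm v"
        using d0 by (simp add: K'_def algebra_simps)
      finally show ?thesis
        using v by simp
    qed
  qed
  ultimately show ?case
    by blast
qed

text \<open>A spanning set may be dependent, so a basis is extracted from it first. The functional
  \<open>c b\<close> is the coordinate for \<open>b\<close> in the basis and 0 for all other
  \<open>b\<close>, so it is bounded linear for every index.\<close>

lemma finite_dim_coordinates:
  assumes "finite_dim TYPE('b::real_normed_vector)"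
  obtains B and c :: "'b::real_normed_vector \<Rightarrow> 'b \<Rightarrow> real"
  where "finite B" "\<And>b. bounded_linear (c b)" "\<And>v. v = (\<Sum>b\<in>B. c b v *\<^sub>R b)"
proof -
  obtain B0 :: "'b set" where B0: "finite B0" "span B0 = UNIV"
    using assms by (auto simp: finite_dim_def)
  obtain B where B: "B \<subseteq> B0" "independent B" "span B0 \<subseteq> span B"
    by (metis maximal_independent_subset span_mono span_span)
  then have fin: "finite B" and span: "span B = UNIV"
    using B0 finite_subset by auto
  define c where "c b v = representation B v b" for b v :: 'b
  have eq: "v = (\<Sum>b\<in>B. c b v *\<^sub>R b)" for v
    using sum_representation_eq[OF B(2) _ fin order_refl, of v] span by (simp add: c_def)
  obtain K where "K \<ge> 0" and K: "\<And>c b. b \<in> B \<Longrightarrow> \<bar>c b\<bar> \<le> K * norm (\<Sum>b\<in>B. c b *\<^sub>R b)"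
    using finite_independent_coords_bounded[OF fin B(2)] by blast
  have bl: "bounded_linear (c b)" for b
  proof (rule bounded_linear_intro)
    show "c b (x + y) = c b x + c b y" for x y
      using span B(2) by (simp add: c_def representation_add)
    show "c b (r *\<^sub>R x) = r *\<^sub>R c b x" for r x
      using span B(2) by (simp add: c_def representation_scale)
    show "norm (c b x) \<le> norm x * K" for x
    proof (cases "b \<in> B")
      case True
      then show ?thesis
        using K[OF True, of "\<lambda>b. c b x"] eq[of x] by (simp add: mult.commute)
    next
      case False
      then have "c b x = 0"
        using representation_ne_zero unfolding c_def by blast
      then show ?thesis using \<open>K \<ge> 0\<close> by simp
    qed
  qed
  show thesis
    using fin bl eq by (rule that)
qed

section \<open>Smooth functions\<close>

lemma C_k_on_Suc_imp: "C_k_on (Suc k) S f \<Longrightarrow> C_k_on k S f"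
proof (induction k arbitrary: f)
  case 0
  then show ?case
    by (auto intro!: continuous_at_imp_continuous_on differentiable_imp_continuous_within)
next
  case (Suc k)
  then show ?case by (metis C_k_on.simps(2))
qed

text \<open>A Frechet derivative depends on the function in a whole neighbourhood of the point;
  openness of \<open>S\<close> supplies one on which the functions agree.\<close>

lemma C_k_on_cong:
  assumes "open S" "\<And>x. x \<in> S \<Longrightarrow> f x = g x" "C_k_on k S f"
  shows "C_k_on k S g"
  using assms(2,3)
proof (induction k arbitrary: f g)
  case 0
  then show ?case
    by (metis C_k_on.simps(1) continuous_on_cong)
next
  case (Suc k)
  have diff: "f differentiable (at x)" if "x \<in> S" for x
    using Suc.prems that by simp
  have "g differentiable (at x)" if "x \<in> S" for x
    using diff[OF that] has_derivative_transform_within_open[OF _ assms(1) that] Suc.prems(1)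
    unfolding differentiable_def by metis
  moreover have "C_k_on k S (\<lambda>x. frechet_derivative g (at x) v)" for v
  proof (rule Suc.IH)
    show "C_k_on k S (\<lambda>x. frechet_derivative f (at x) v)"
      using Suc.prems by simp
    show "frechet_derivative f (at x) v = frechet_derivative g (at x) v" if "x \<in> S" for x
      using frechet_derivative_transform_within_open[OF diff[OF that] assms(1) that] Suc.prems(1)
      by metis
  qed
  ultimately show ?case by simp
qed

lemma C_k_on_subset: "T \<subseteq> S \<Longrightarrow> C_k_on k S f \<Longrightarrow> C_k_on k T f"
  by (induction k arbitrary: f) (auto intro: continuous_on_subset)

lemma C_k_on_local:
  assumes "\<And>x. x \<in> S \<Longrightarrow> \<exists>T. open T \<and> x \<in> T \<and> C_k_on k T f"
  shows "C_k_on k S f"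
  using assms
proof (induction k arbitrary: f)
  case 0
  then show ?case
    by (auto intro!: continuous_at_imp_continuous_on)
      (meson continuous_on_eq_continuous_at)
next
  case (Suc k)
  then show ?case
    by (auto; metis)
qed

lemma C_k_on_const: "C_k_on k S (\<lambda>x. c)"
  by (induction k arbitrary: c) auto

lemma C_k_on_add:
  assumes "open S" "C_k_on k S f" "C_k_on k S g"
  shows "C_k_on k S (\<lambda>x. f x + g x)"
  using assms(2,3)
proof (induction k arbitrary: f g)
  case 0
  then show ?case by (simp add: continuous_on_add)
next
  case (Suc k)
  have "C_k_on k S (\<lambda>x. frechet_derivative (\<lambda>x. f x + g x) (at x) v)" for v
  proof (rule C_k_on_cong[OF assms(1)])
    show "C_k_on k S (\<lambda>x. frechet_derivative f (at x) v + frechet_derivative g (at x) v)"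
      using Suc by simp
    show "frechet_derivative f (at x) v + frechet_derivative g (at x) v
        = frechet_derivative (\<lambda>x. f x + g x) (at x) v" if "x \<in> S" for x
    proof -
      have "((\<lambda>x. f x + g x) has_derivative
          (\<lambda>v. frechet_derivative f (at x) v + frechet_derivative g (at x) v)) (at x)"
        using Suc.prems that by (auto intro!: has_derivative_add simp flip: frechet_derivative_works)
      then show ?thesis by (metis frechet_derivative_at)
    qed
  qed
  then show ?case using Suc.prems by simp
qed

lemma C_k_on_sum:
  assumes "open S" "\<And>i. i \<in> I \<Longrightarrow> C_k_on k S (f i)"
  shows "C_k_on k S (\<lambda>x. \<Sum>i\<in>I. f i x)"
  using assms(2)
  by (induction I rule: infinite_finite_induct) (auto simp: C_k_on_const C_k_on_add assms(1))

lemma C_k_on_bounded_linear: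
  assumes "open S" "bounded_linear l" "C_k_on k S f"
  shows "C_k_on k S (\<lambda>x. l (f x))"
  using assms(3)
proof (induction k arbitrary: f)
  case 0
  then show ?case
    by (simp add: bounded_linear.continuous_on[OF assms(2)])
next
  case (Suc k)
  have deriv: "((\<lambda>x. l (f x)) has_derivative (\<lambda>v. l (frechet_derivative f (at x) v))) (at x)"
    if "x \<in> S" for x
    using Suc.prems that
    by (auto intro!: bounded_linear.has_derivative[OF assms(2)] simp flip: frechet_derivative_works)
  have "C_k_on k S (\<lambda>x. frechet_derivative (\<lambda>x. l (f x)) (at x) v)" for v
  proof (rule C_k_on_cong[OF assms(1)])
    show "C_k_on k S (\<lambda>x. l (frechet_derivative f (at x) v))"
      using Suc by simp
    show "l (frechet_derivative f (at x) v) = frechet_derivative (\<lambda>x. l (f x)) (at x) v"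
      if "x \<in> S" for x
      using deriv[OF that] by (metis frechet_derivative_at)
  qed
  then show ?case
    using deriv by (auto simp: differentiable_def)
qed

lemma C_k_on_scaleR:
  fixes f :: "'b::real_normed_vector \<Rightarrow> real"
  assumes "open S" "C_k_on k S f" "C_k_on k S g"
  shows "C_k_on k S (\<lambda>x. f x *\<^sub>R g x)"
  using assms(2,3)
proof (induction k arbitrary: f g)
  case 0
  then show ?case by (simp add: continuous_on_scaleR)
next
  case (Suc k)
  have deriv: "((\<lambda>x. f x *\<^sub>R g x) has_derivative
      (\<lambda>v. f x *\<^sub>R frechet_derivative g (at x) v + frechet_derivative f (at x) v *\<^sub>R g x)) (at x)"
    if "x \<in> S" for x
    using Suc.prems that by (auto intro!: has_derivative_scaleR simp flip: frechet_derivative_works)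
  have "C_k_on k S (\<lambda>x. frechet_derivative (\<lambda>x. f x *\<^sub>R g x) (at x) v)" for v
  proof (rule C_k_on_cong[OF assms(1)])
    \<comment> \<open>The product rule multiplies a derivative by an undifferentiated factor, which
      must first be lowered from order \<open>Suc k\<close> to \<open>k\<close> for the induction
      hypothesis to apply.\<close>
    show "C_k_on k S
        (\<lambda>x. f x *\<^sub>R frechet_derivative g (at x) v + frechet_derivative f (at x) v *\<^sub>R g x)"
      using Suc.prems C_k_on_Suc_imp[OF Suc.prems(1)] C_k_on_Suc_imp[OF Suc.prems(2)]
      by (intro C_k_on_add[OF assms(1)] Suc.IH) auto
    show "f x *\<^sub>R frechet_derivative g (at x) v + frechet_derivative f (at x) v *\<^sub>R g x
        = frechet_derivative (\<lambda>x. f x *\<^sub>R g x) (at x) v" if "x \<in> S" for x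
      using deriv[OF that] by (metis frechet_derivative_at)
  qed
  then show ?case
    using deriv by (auto simp: differentiable_def)
qed

lemma smooth_on_const: "smooth_on S (\<lambda>x. c)"
  by (simp add: smooth_on_def C_k_on_const)

lemma smooth_on_add:
  "open S \<Longrightarrow> smooth_on S f \<Longrightarrow> smooth_on S g \<Longrightarrow> smooth_on S (\<lambda>x. f x + g x)"
  by (simp add: smooth_on_def C_k_on_add)

lemma smooth_on_sum:
  "open S \<Longrightarrow> (\<And>i. i \<in> I \<Longrightarrow> smooth_on S (f i)) \<Longrightarrow> smooth_on S (\<lambda>x. \<Sum>i\<in>I. f i x)"
  by (simp add: smooth_on_def C_k_on_sum)

lemma smooth_on_scaleR:
  fixes f :: "'b::real_normed_vector \<Rightarrow> real"
  shows "open S \<Longrightarrow> smooth_on S f \<Longrightarrow> smooth_on S g \<Longrightarrow> smooth_on S (\<lambda>x. f x *\<^sub>R g x)"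
  by (simp add: smooth_on_def C_k_on_scaleR)

lemma smooth_on_mult:
  fixes f g :: "'b::real_normed_vector \<Rightarrow> real"
  shows "open S \<Longrightarrow> smooth_on S f \<Longrightarrow> smooth_on S g \<Longrightarrow> smooth_on S (\<lambda>x. f x * g x)"
  using smooth_on_scaleR[of S f g] by simp

lemma smooth_on_bounded_linear:
  "open S \<Longrightarrow> bounded_linear l \<Longrightarrow> smooth_on S f \<Longrightarrow> smooth_on S (\<lambda>x. l (f x))"
  by (simp add: smooth_on_def C_k_on_bounded_linear)

lemma smooth_on_frechet_derivative:
  "smooth_on S f \<Longrightarrow> smooth_on S (\<lambda>x. frechet_derivative f (at x) v)"
  unfolding smooth_on_def by (metis C_k_on.simps(2))

lemma smooth_on_differentiable: "smooth_on S f \<Longrightarrow> x \<in> S \<Longrightarrow> f differentiable (at x)"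
  unfolding smooth_on_def by (metis C_k_on.simps(2))

lemma smooth_on_cong:
  "open S \<Longrightarrow> (\<And>x. x \<in> S \<Longrightarrow> f x = g x) \<Longrightarrow> smooth_on S f \<Longrightarrow> smooth_on S g"
  unfolding smooth_on_def using C_k_on_cong by blast

lemma smooth_on_subset: "T \<subseteq> S \<Longrightarrow> smooth_on S f \<Longrightarrow> smooth_on T f"
  by (auto simp: smooth_on_def intro: C_k_on_subset)

lemma smooth_on_local:
  assumes "\<And>x. x \<in> S \<Longrightarrow> \<exists>T. open T \<and> x \<in> T \<and> smooth_on T f"
  shows "smooth_on S f"
  unfolding smooth_on_def
proof
  show "C_k_on k S f" for k
    using assms unfolding smooth_on_def by (intro C_k_on_local) blast
qed

section \<open>Shuffles and the exterior product\<close>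

lemma finite_shuffle_perms: "finite (shuffle_perms p n)"
  by (rule finite_subset[OF _ finite_permutations[of "{..<n}"]]) (auto simp: shuffle_perms_def)

lemma shuffle_perms_0: "shuffle_perms 0 0 = {id}"
  by (auto simp: shuffle_perms_def monotone_on_def)

text \<open>Conjugation of \<tau> by \<open>Suc\<close>, leaving a fixed point at 0. Written with
  \<open>map_permutation\<close>, it inherits the sign of \<tau>.\<close>

definition lift_perm :: "nat \<Rightarrow> (nat \<Rightarrow> nat) \<Rightarrow> nat \<Rightarrow> nat" where
  "lift_perm n = map_permutation {..<n} Suc"

lemma bij_betw_Suc_lessThan: "bij_betw Suc {..<n} {0<..<Suc n}"
  by (rule bij_betwI[of _ _ _ "\<lambda>i. i - 1"]) auto

lemma lift_perm_0: "lift_perm n \<tau> 0 = 0"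
  by (simp add: lift_perm_def map_permutation_def restrict_id_def image_iff)

lemma lift_perm_Suc: "\<tau> permutes {..<n} \<Longrightarrow> lift_perm n \<tau> (Suc i) = Suc (\<tau> i)"
  by (cases "i < n")
    (auto simp: lift_perm_def map_permutation_apply map_permutation_def restrict_id_def
      permutes_not_in image_iff)

lemma sign_lift_perm: "\<tau> permutes {..<n} \<Longrightarrow> sign (lift_perm n \<tau>) = sign \<tau>"
  by (simp add: lift_perm_def sign_map_permutation)

lemma lift_perm_permutes:
  assumes "\<tau> permutes {..<n}"
  shows "lift_perm n \<tau> permutes {..<Suc n}"
  by (rule permutes_subset[OF map_permutation_permutes[OF bij_betw_Suc_lessThan assms], folded lift_perm_def])
    auto

lemma permutes_fixing_0_lift:
  assumes "\<sigma> permutes {..<Suc n}" "\<sigma> 0 = 0"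
  obtains \<tau> where "\<tau> permutes {..<n}" "\<sigma> = lift_perm n \<tau>"
proof
  have "inj \<sigma>"
    using assms(1) by (rule permutes_inj)
  then have nz: "\<sigma> (Suc i) \<noteq> 0" for i
    using assms(2) by (metis inj_eq nat.distinct(1))
  define \<tau> where "\<tau> i = \<sigma> (Suc i) - 1" for i
  have \<sigma>: "\<sigma> (Suc i) = Suc (\<tau> i)" for i
    using nz[of i] by (simp add: \<tau>_def)
  have "inj \<tau>"
    using \<open>inj \<sigma>\<close> by (metis \<sigma> injI inj_eq nat.inject)
  moreover have "\<tau> ` {..<n} \<subseteq> {..<n}"
  proof
    fix j assume "j \<in> \<tau> ` {..<n}"
    then obtain i where "i < n" "j = \<tau> i" by auto
    then have "\<sigma> (Suc i) < Suc n"
      using permutes_in_image[OF assms(1), of "Suc i"] by simp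
    then show "j \<in> {..<n}"
      using \<sigma> \<open>j = \<tau> i\<close> by simp
  qed
  ultimately have "bij_betw \<tau> {..<n} {..<n}"
    by (metis bij_betw_def endo_inj_surj finite_lessThan inj_on_subset subset_UNIV)
  moreover have "\<tau> i = i" if "i \<notin> {..<n}" for i
    using permutes_not_in[OF assms(1), of "Suc i"] that by (simp add: \<tau>_def)
  ultimately show \<tau>: "\<tau> permutes {..<n}"
    by (rule bij_imp_permutes)
  show "\<sigma> = lift_perm n \<tau>"
  proof
    show "\<sigma> i = lift_perm n \<tau> i" for i
      by (cases i) (simp_all add: assms(2) lift_perm_0 lift_perm_Suc[OF \<tau>] \<sigma>)
  qed
qed

text \<open>The cycle 0, 1, ..., p as a product of p adjacent transpositions, so that its sign is
  immediate. It brings position \<open>p\<close> to the front and keeps the order of the other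
  positions.\<close>

primrec front_cycle :: "nat \<Rightarrow> nat \<Rightarrow> nat" where
  "front_cycle 0 = id"
| "front_cycle (Suc p) = front_cycle p \<circ> Transposition.transpose p (Suc p)"

lemma front_cycle_apply:
  "front_cycle p i = (if i < p then Suc i else if i = p then 0 else i)"
  by (induction p arbitrary: i) (auto simp: Transposition.transpose_def)

lemma front_cycle_permutes: "front_cycle p permutes {..p}"
proof (induction p)
  case (Suc p)
  have "front_cycle p permutes {..Suc p}"
    using Suc by (rule permutes_subset) auto
  then show ?case
    unfolding front_cycle.simps by (intro permutes_compose permutes_swap_id) auto
qed (simp add: permutes_def)

lemma sign_front_cycle: "sign (front_cycle p) = (-1) ^ p"
proof (induction p)
  case (Suc p)
  have "permutation (front_cycle p)"
    using front_cycle_permutes permutes_imp_permutation finite_atMost by blast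
  then show ?case
    unfolding front_cycle.simps
    by (simp add: sign_compose sign_swap_id permutation_swap_id Suc del: comp_apply)
qed simp

text \<open>Deleting the first argument from the head of the first block leaves a shuffle whose
  first block is shorter by one.\<close>

lemma shuffle_perms_Suc_front:
  "{\<sigma> \<in> shuffle_perms (Suc p) (Suc n). \<sigma> 0 = 0} = lift_perm n ` shuffle_perms p n"
proof (intro equalityI subsetI)
  fix \<sigma> assume "\<sigma> \<in> {\<sigma> \<in> shuffle_perms (Suc p) (Suc n). \<sigma> 0 = 0}"
  then have \<sigma>: "\<sigma> permutes {..<Suc n}" "\<sigma> 0 = 0"
    and mono: "strict_mono_on {..<Suc p} \<sigma>" "strict_mono_on {Suc p..<Suc n} \<sigma>"
    by (auto simp: shuffle_perms_def)
  obtain \<tau> where \<tau>: "\<tau> permutes {..<n}" "\<sigma> = lift_perm n \<tau>"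
    by (rule permutes_fixing_0_lift[OF \<sigma>])
  have Suc_eq: "\<sigma> (Suc i) = Suc (\<tau> i)" for i
    by (simp add: \<tau> lift_perm_Suc)
  have "\<tau> \<in> shuffle_perms p n"
    unfolding shuffle_perms_def mem_Collect_eq
  proof (intro conjI strict_mono_onI)
    show "\<tau> r < \<tau> s" if "r \<in> {..<p}" "s \<in> {..<p}" "r < s" for r s
      using strict_mono_onD[OF mono(1), of "Suc r" "Suc s"] that by (simp add: Suc_eq)
    show "\<tau> r < \<tau> s" if "r \<in> {p..<n}" "s \<in> {p..<n}" "r < s" for r s
      using strict_mono_onD[OF mono(2), of "Suc r" "Suc s"] that by (simp add: Suc_eq)
  qed (fact \<tau>(1))
  then show "\<sigma> \<in> lift_perm n ` shuffle_perms p n"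
    using \<tau>(2) by blast
next
  fix \<sigma> assume "\<sigma> \<in> lift_perm n ` shuffle_perms p n"
  then obtain \<tau> where \<tau>: "\<tau> permutes {..<n}" "\<sigma> = lift_perm n \<tau>"
    and mono: "strict_mono_on {..<p} \<tau>" "strict_mono_on {p..<n} \<tau>"
    by (auto simp: shuffle_perms_def)
  have Suc_eq: "\<sigma> (Suc i) = Suc (\<tau> i)" for i
    by (simp add: \<tau> lift_perm_Suc)
  have zero: "\<sigma> 0 = 0"
    by (simp add: \<tau> lift_perm_0)
  have "\<sigma> \<in> shuffle_perms (Suc p) (Suc n)"
    unfolding shuffle_perms_def mem_Collect_eq
  proof (intro conjI strict_mono_onI)
    show "\<sigma> permutes {..<Suc n}"
      unfolding \<tau>(2) by (rule lift_perm_permutes[OF \<tau>(1)])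
    show "\<sigma> r < \<sigma> s" if "r \<in> {..<Suc p}" "s \<in> {..<Suc p}" "r < s" for r s
      using strict_mono_onD[OF mono(1), of "r - 1" "s - 1"] that
      by (cases r; cases s) (auto simp: Suc_eq zero)
    show "\<sigma> r < \<sigma> s" if "r \<in> {Suc p..<Suc n}" "s \<in> {Suc p..<Suc n}" "r < s" for r s
      using strict_mono_onD[OF mono(2), of "r - 1" "s - 1"] that
      by (cases r; cases s) (auto simp: Suc_eq zero)
  qed
  with zero show "\<sigma> \<in> {\<sigma> \<in> shuffle_perms (Suc p) (Suc n). \<sigma> 0 = 0}"
    by simp
qed

text \<open>Here the first argument heads the second block, at position \<open>p\<close>. The cycle
  carries it to the front past the whole first block, after which it can be deleted; the first block
  keeps its length.\<close>

lemma shuffle_perms_Suc_back: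
  assumes "p \<le> n"
  shows "{\<sigma> \<in> shuffle_perms p (Suc n). \<sigma> p = 0} =
    (\<lambda>\<tau>. lift_perm n \<tau> \<circ> front_cycle p) ` shuffle_perms p n"
proof (intro equalityI subsetI)
  fix \<sigma> assume "\<sigma> \<in> {\<sigma> \<in> shuffle_perms p (Suc n). \<sigma> p = 0}"
  then have \<sigma>: "\<sigma> permutes {..<Suc n}" "\<sigma> p = 0"
    and mono: "strict_mono_on {..<p} \<sigma>" "strict_mono_on {p..<Suc n} \<sigma>"
    by (auto simp: shuffle_perms_def)
  have fc: "front_cycle p permutes {..<Suc n}"
    by (rule permutes_subset[OF front_cycle_permutes]) (use assms in auto)
  have inv: "inv (front_cycle p) 0 = p"
    by (rule inv_f_eq[OF permutes_inj[OF fc]]) (simp add: front_cycle_apply)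
  have "\<sigma> \<circ> inv (front_cycle p) permutes {..<Suc n}"
    by (rule permutes_compose[OF permutes_inv[OF fc] \<sigma>(1)])
  moreover have "(\<sigma> \<circ> inv (front_cycle p)) 0 = 0"
    by (simp add: inv \<sigma>)
  ultimately obtain \<tau> where \<tau>: "\<tau> permutes {..<n}"
    "\<sigma> \<circ> inv (front_cycle p) = lift_perm n \<tau>"
    by (rule permutes_fixing_0_lift)
  have eq: "\<sigma> = lift_perm n \<tau> \<circ> front_cycle p"
    unfolding \<tau>(2)[symmetric] by (simp add: o_assoc[symmetric] permutes_inv_o(2)[OF fc])
  have lo: "\<sigma> i = Suc (\<tau> i)" if "i < p" for i
    using that by (simp add: eq front_cycle_apply lift_perm_Suc[OF \<tau>(1)])
  have hi: "\<sigma> (Suc i) = Suc (\<tau> i)" if "p \<le> i" for i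
    using that by (simp add: eq front_cycle_apply lift_perm_Suc[OF \<tau>(1)])
  have "\<tau> \<in> shuffle_perms p n"
    unfolding shuffle_perms_def mem_Collect_eq
  proof (intro conjI strict_mono_onI)
    show "\<tau> r < \<tau> s" if "r \<in> {..<p}" "s \<in> {..<p}" "r < s" for r s
      using strict_mono_onD[OF mono(1), of r s] that by (simp add: lo)
    show "\<tau> r < \<tau> s" if "r \<in> {p..<n}" "s \<in> {p..<n}" "r < s" for r s
      using strict_mono_onD[OF mono(2), of "Suc r" "Suc s"] that by (simp add: hi)
  qed (fact \<tau>(1))
  then show "\<sigma> \<in> (\<lambda>\<tau>. lift_perm n \<tau> \<circ> front_cycle p) ` shuffle_perms p n"
    using eq by blast
next
  fix \<sigma> assume "\<sigma> \<in> (\<lambda>\<tau>. lift_perm n \<tau> \<circ> front_cycle p) ` shuffle_perms p n"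
  then obtain \<tau> where \<tau>: "\<tau> permutes {..<n}" and eq: "\<sigma> = lift_perm n \<tau> \<circ> front_cycle p"
    and mono: "strict_mono_on {..<p} \<tau>" "strict_mono_on {p..<n} \<tau>"
    by (auto simp: shuffle_perms_def)
  have fc: "front_cycle p permutes {..<Suc n}"
    by (rule permutes_subset[OF front_cycle_permutes]) (use assms in auto)
  have lo: "\<sigma> i = Suc (\<tau> i)" if "i < p" for i
    using that by (simp add: eq front_cycle_apply lift_perm_Suc[OF \<tau>(1)])
  have hi: "\<sigma> (Suc i) = Suc (\<tau> i)" if "p \<le> i" for i
    using that by (simp add: eq front_cycle_apply lift_perm_Suc[OF \<tau>(1)])
  have zero: "\<sigma> p = 0"
    by (simp add: eq front_cycle_apply lift_perm_0)
  have "\<sigma> \<in> shuffle_perms p (Suc n)"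
    unfolding shuffle_perms_def mem_Collect_eq
  proof (intro conjI strict_mono_onI)
    show "\<sigma> permutes {..<Suc n}"
      unfolding eq by (rule permutes_compose[OF fc lift_perm_permutes[OF \<tau>(1)]])
    show "\<sigma> r < \<sigma> s" if "r \<in> {..<p}" "s \<in> {..<p}" "r < s" for r s
      using strict_mono_onD[OF mono(1), of r s] that by (simp add: lo)
    show "\<sigma> r < \<sigma> s" if rs: "r \<in> {p..<Suc n}" "s \<in> {p..<Suc n}" "r < s" for r s
    proof -
      obtain s' where s: "s = Suc s'"
        using rs by (cases s) auto
      show ?thesis
      proof (cases "r = p")
        case True
        then show ?thesis using rs by (simp add: zero s hi)
      next
        case False
        then obtain r' where r: "r = Suc r'" and "p \<le> r'"
          using rs by (metis Suc_le_eq atLeastLessThan_iff le_neq_implies_less less_Suc_eq_le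
              not0_implies_Suc not_less_zero)
        show ?thesis
          using strict_mono_onD[OF mono(2), of r' s'] that \<open>p \<le> r'\<close> by (simp add: r s hi)
      qed
    qed
  qed
  with zero show "\<sigma> \<in> {\<sigma> \<in> shuffle_perms p (Suc n). \<sigma> p = 0}"
    by simp
qed

lemma inj_on_lift_perm: "inj_on (lift_perm n) (shuffle_perms p n)"
proof (rule inj_onI)
  fix \<tau> \<tau>' assume "\<tau> \<in> shuffle_perms p n" "\<tau>' \<in> shuffle_perms p n"
    and eq: "lift_perm n \<tau> = lift_perm n \<tau>'"
  then have "\<tau> permutes {..<n}" "\<tau>' permutes {..<n}"
    by (auto simp: shuffle_perms_def)
  then have "Suc (\<tau> i) = Suc (\<tau>' i)" for i
    using eq by (metis lift_perm_Suc)
  then show "\<tau> = \<tau>'" by auto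
qed

lemma inj_on_lift_perm_front_cycle:
  "inj_on (\<lambda>\<tau>. lift_perm n \<tau> \<circ> front_cycle p) (shuffle_perms p n)"
proof (rule inj_onI)
  fix \<tau> \<tau>' assume \<tau>: "\<tau> \<in> shuffle_perms p n" "\<tau>' \<in> shuffle_perms p n"
    and eq: "lift_perm n \<tau> \<circ> front_cycle p = lift_perm n \<tau>' \<circ> front_cycle p"
  have "surj (front_cycle p)"
    using front_cycle_permutes by (rule permutes_surj)
  then have "lift_perm n \<tau> = lift_perm n \<tau>'"
    using eq by (metis comp_apply ext surjD)
  then show "\<tau> = \<tau>'"
    using inj_on_lift_perm \<tau> by (metis inj_onD)
qed

text \<open>A shuffle increases on each block, so the value 0 can occur only at the head of a block.
  The inequalities say that this block is nonempty.\<close>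

lemma shuffle_perms_zero_cases:
  assumes "\<sigma> \<in> shuffle_perms p (Suc n)" "p \<le> Suc n"
  shows "p > 0 \<and> \<sigma> 0 = 0 \<or> p \<le> n \<and> \<sigma> p = 0"
proof -
  have \<sigma>: "\<sigma> permutes {..<Suc n}"
    and mono: "strict_mono_on {..<p} \<sigma>" "strict_mono_on {p..<Suc n} \<sigma>"
    using assms(1) by (auto simp: shuffle_perms_def)
  obtain k where k: "\<sigma> k = 0" "k < Suc n"
    using permutes_image[OF \<sigma>] by (metis image_iff lessThan_iff zero_less_Suc)
  show ?thesis
  proof (cases "k < p")
    case True
    then show ?thesis
      using strict_mono_onD[OF mono(1), of 0 k] k by (cases "k = 0") auto
  next
    case False
    then have "k = p"
      using strict_mono_onD[OF mono(2), of p k] k by (cases "k = p") auto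
    then show ?thesis using k by auto
  qed
qed

text \<open>The two sums collect the shuffles that send the first argument to the first or to the
  second block. The extreme lengths, where that block would be empty, contribute nothing
  (\<open>X 0\<close> and \<open>Y (Suc n)\<close> are empty), so both sums run over the same
  range.\<close>

lemma sum_shuffle_perms_Suc:
  fixes F :: "nat \<Rightarrow> (nat \<Rightarrow> nat) \<Rightarrow> real"
  shows "(\<Sum>p\<le>Suc n. \<Sum>\<sigma>\<in>shuffle_perms p (Suc n). F p \<sigma>) =
    (\<Sum>p\<le>n. \<Sum>\<tau>\<in>shuffle_perms p n. F (Suc p) (lift_perm n \<tau>)) +
    (\<Sum>p\<le>n. \<Sum>\<tau>\<in>shuffle_perms p n. F p (lift_perm n \<tau> \<circ> front_cycle p))"
proof -
  define X where "X p = {\<sigma> \<in> shuffle_perms p (Suc n). p > 0 \<and> \<sigma> 0 = 0}" for p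
  define Y where "Y p = {\<sigma> \<in> shuffle_perms p (Suc n). p \<le> n \<and> \<sigma> p = 0}" for p
  have fin: "finite (X p)" "finite (Y p)" for p
    by (auto simp: X_def Y_def finite_shuffle_perms)
  have disj: "X p \<inter> Y p = {}" for p
  proof -
    have "False" if "\<sigma> \<in> X p" "\<sigma> \<in> Y p" for \<sigma>
    proof -
      have "inj \<sigma>"
        using that by (auto simp: X_def shuffle_perms_def intro: permutes_inj)
      moreover have "\<sigma> 0 = \<sigma> p" "p \<noteq> 0"
        using that by (auto simp: X_def Y_def)
      ultimately show False
        by (metis injD)
    qed
    then show ?thesis by blast
  qed
  have "(\<Sum>\<sigma>\<in>shuffle_perms p (Suc n). F p \<sigma>) = sum (F p) (X p) + sum (F p) (Y p)"
    if "p \<le> Suc n" for p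
  proof -
    have "shuffle_perms p (Suc n) = X p \<union> Y p"
      using shuffle_perms_zero_cases[OF _ that] unfolding X_def Y_def by blast
    then show ?thesis
      by (simp add: sum.union_disjoint fin disj)
  qed
  then have "(\<Sum>p\<le>Suc n. \<Sum>\<sigma>\<in>shuffle_perms p (Suc n). F p \<sigma>) =
      (\<Sum>p\<le>Suc n. sum (F p) (X p)) + (\<Sum>p\<le>Suc n. sum (F p) (Y p))"
    by (simp add: sum.distrib)
  also have "(\<Sum>p\<le>Suc n. sum (F p) (X p)) = (\<Sum>p\<le>n. sum (F (Suc p)) (X (Suc p)))"
    by (subst sum.atMost_Suc_shift) (simp add: X_def)
  also have "\<dots> = (\<Sum>p\<le>n. \<Sum>\<tau>\<in>shuffle_perms p n. F (Suc p) (lift_perm n \<tau>))"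
    by (simp add: X_def shuffle_perms_Suc_front sum.reindex[OF inj_on_lift_perm])
  also have "(\<Sum>p\<le>Suc n. sum (F p) (Y p)) = (\<Sum>p\<le>n. sum (F p) (Y p))"
    by (simp add: Y_def)
  also have "\<dots> = (\<Sum>p\<le>n. \<Sum>\<tau>\<in>shuffle_perms p n. F p (lift_perm n \<tau> \<circ> front_cycle p))"
    by (rule sum.cong)
      (auto simp: Y_def shuffle_perms_Suc_back sum.reindex[OF inj_on_lift_perm_front_cycle])
  finally show ?thesis .
qed

lemma map_lift_perm_front:
  assumes "\<tau> permutes {..<n}"
  shows "map (\<lambda>i. (V # Vs) ! lift_perm n \<tau> i) [0..<Suc p] = V # map (\<lambda>i. Vs ! \<tau> i) [0..<p]"
    and "map (\<lambda>i. (V # Vs) ! lift_perm n \<tau> i) [Suc p..<Suc n] = map (\<lambda>i. Vs ! \<tau> i) [p..<n]"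
  by (simp_all add: lift_perm_0 lift_perm_Suc[OF assms] map_upt_Suc map_Suc_upt[symmetric] o_def
      del: upt_Suc map_Suc_upt)

lemma map_lift_perm_back:
  assumes "\<tau> permutes {..<n}" "p \<le> n"
  shows "map (\<lambda>i. (V # Vs) ! (lift_perm n \<tau> \<circ> front_cycle p) i) [0..<p] = map (\<lambda>i. Vs ! \<tau> i) [0..<p]"
    and "map (\<lambda>i. (V # Vs) ! (lift_perm n \<tau> \<circ> front_cycle p) i) [p..<Suc n] =
      V # map (\<lambda>i. Vs ! \<tau> i) [p..<n]"
proof -
  show "map (\<lambda>i. (V # Vs) ! (lift_perm n \<tau> \<circ> front_cycle p) i) [0..<p] = map (\<lambda>i. Vs ! \<tau> i) [0..<p]"
    by (simp add: front_cycle_apply lift_perm_Suc[OF assms(1)])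
  have "[p..<Suc n] = p # map Suc [p..<n]"
    using assms(2) by (simp add: upt_conv_Cons map_Suc_upt del: upt_Suc)
  then show "map (\<lambda>i. (V # Vs) ! (lift_perm n \<tau> \<circ> front_cycle p) i) [p..<Suc n] =
      V # map (\<lambda>i. Vs ! \<tau> i) [p..<n]"
    by (simp add: front_cycle_apply lift_perm_0 lift_perm_Suc[OF assms(1)] o_def del: upt_Suc map_Suc_upt)
qed

lemma sign_lift_perm_front_cycle:
  assumes "\<tau> permutes {..<n}"
  shows "sign (lift_perm n \<tau> \<circ> front_cycle p) = sign \<tau> * (-1) ^ p"
proof -
  have "permutation (lift_perm n \<tau>)"
    using lift_perm_permutes[OF assms] permutes_imp_permutation finite_lessThan by blast
  moreover have "permutation (front_cycle p)"
    using front_cycle_permutes permutes_imp_permutation finite_atMost by blast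
  ultimately show ?thesis
    by (simp add: sign_compose sign_lift_perm[OF assms] sign_front_cycle)
qed

text \<open>
  The sign \<open>(-1)\<^sup>p\<close> of the antiderivation rules, as an operator that also makes sense on
  inhomogeneous forms.
\<close>

definition form_hat :: "('m, 'e) form \<Rightarrow> ('m, 'e) form" where
  "form_hat \<eta> = (\<lambda>Vs x. (-1) ^ length Vs * \<eta> Vs x)"

text \<open>Sending \<open>V\<close> to the second factor moves it past the \<open>p\<close>
  arguments of \<eta> and costs \<open>(-1) ^ p\<close>. As \<eta> is evaluated there on a list of
  length \<open>p\<close>, this sign is exactly \<open>form_hat\<close>, for every summand at
  once.\<close>

lemma interior_product_wedge:
  fixes \<eta> \<zeta> :: "('m, 'e) form"
  shows "interior_product V (wedge \<eta> \<zeta>) =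
    form_add (wedge (interior_product V \<eta>) \<zeta>) (wedge (form_hat \<eta>) (interior_product V \<zeta>))"
proof (intro ext)
  fix Vs :: "('m \<Rightarrow> 'e) list" and x
  define n where "n = length Vs"
  let ?W = "\<lambda>(\<alpha>::('m, 'e) form) (\<beta>::('m, 'e) form) (Us::('m \<Rightarrow> 'e) list) m p (\<sigma>::nat\<Rightarrow>nat).
      of_int (sign \<sigma>) * \<alpha> (map (\<lambda>i. Us ! \<sigma> i) [0..<p]) x * \<beta> (map (\<lambda>i. Us ! \<sigma> i) [p..<m]) x"
  have perm: "\<tau> permutes {..<n}" if "\<tau> \<in> shuffle_perms p n" for \<tau> p
    using that by (simp add: shuffle_perms_def)
  have "interior_product V (wedge \<eta> \<zeta>) Vs x =
      (\<Sum>p\<le>Suc n. \<Sum>\<sigma>\<in>shuffle_perms p (Suc n). ?W \<eta> \<zeta> (V # Vs) (Suc n) p \<sigma>)"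
    by (simp add: interior_product_def wedge_def n_def Let_def del: sum.atMost_Suc)
  also have "\<dots> =
      (\<Sum>p\<le>n. \<Sum>\<tau>\<in>shuffle_perms p n. ?W \<eta> \<zeta> (V # Vs) (Suc n) (Suc p) (lift_perm n \<tau>)) +
      (\<Sum>p\<le>n. \<Sum>\<tau>\<in>shuffle_perms p n. ?W \<eta> \<zeta> (V # Vs) (Suc n) p (lift_perm n \<tau> \<circ> front_cycle p))"
    by (rule sum_shuffle_perms_Suc)
  also have "(\<Sum>p\<le>n. \<Sum>\<tau>\<in>shuffle_perms p n. ?W \<eta> \<zeta> (V # Vs) (Suc n) (Suc p) (lift_perm n \<tau>)) =
      wedge (interior_product V \<eta>) \<zeta> Vs x"
    unfolding wedge_def Let_def n_def[symmetric] interior_product_def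
    by (intro sum.cong refl, simp only: map_lift_perm_front[OF perm] sign_lift_perm[OF perm])
  also have "(\<Sum>p\<le>n. \<Sum>\<tau>\<in>shuffle_perms p n.
        ?W \<eta> \<zeta> (V # Vs) (Suc n) p (lift_perm n \<tau> \<circ> front_cycle p)) =
      wedge (form_hat \<eta>) (interior_product V \<zeta>) Vs x"
    unfolding wedge_def Let_def n_def[symmetric] interior_product_def form_hat_def
    by (intro sum.cong refl, simp only: map_lift_perm_back[OF perm] atMost_iff
        sign_lift_perm_front_cycle[OF perm] length_map length_upt of_int_mult of_int_power
        of_int_minus of_int_1 diff_zero mult.assoc)
  finally show "interior_product V (wedge \<eta> \<zeta>) Vs x =
    form_add (wedge (interior_product V \<eta>) \<zeta>) (wedge (form_hat \<eta>) (interior_product V \<zeta>)) Vs x"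
    by (simp add: form_add_def)
qed

section \<open>Algebra of contractions, the degree sign and the exterior product\<close>

lemma omit_Cons: "omit 0 (V # Vs) = Vs" "omit (Suc i) (V # Vs) = V # omit i Vs"
  by (simp_all add: omit_def)

lemma form_hat_simps:
  "form_hat (form_hat \<eta>) = \<eta>"
  "interior_product V (form_hat \<eta>) = form_scale (-1) (form_hat (interior_product V \<eta>))"
  by (simp_all add: form_hat_def interior_product_def form_scale_def mult.assoc[symmetric]
      flip: power_mult_distrib)

lemma interior_product_linear:
  "interior_product V (form_add \<eta> \<zeta>) = form_add (interior_product V \<eta>) (interior_product V \<zeta>)"
  "interior_product V (form_scale c \<eta>) = form_scale c (interior_product V \<eta>)"
  by (simp_all add: interior_product_def form_add_def form_scale_def)

lemma wedge_Nil: "wedge \<eta> \<zeta> [] = (\<lambda>x. \<eta> [] x * \<zeta> [] x)"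
  by (simp add: wedge_def shuffle_perms_0)

lemma wedge_mult_left: "wedge (\<lambda>Vs x. f x * \<eta> Vs x) \<zeta> Vs x = f x * wedge \<eta> \<zeta> Vs x"
  by (simp add: wedge_def Let_def sum_distrib_left mult.assoc mult.left_commute)

lemma wedge_mult_right: "wedge \<eta> (\<lambda>Vs x. f x * \<zeta> Vs x) Vs x = f x * wedge \<eta> \<zeta> Vs x"
  by (simp add: wedge_def Let_def sum_distrib_left mult.assoc mult.left_commute)

lemma wedge_add_left: "wedge (form_add \<eta> \<eta>') \<zeta> Vs x = wedge \<eta> \<zeta> Vs x + wedge \<eta>' \<zeta> Vs x"
  by (simp add: wedge_def Let_def form_add_def algebra_simps sum.distrib)

lemma wedge_add_right: "wedge \<eta> (form_add \<zeta> \<zeta>') Vs x = wedge \<eta> \<zeta> Vs x + wedge \<eta> \<zeta>' Vs x"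
  by (simp add: wedge_def Let_def form_add_def algebra_simps sum.distrib)

lemma wedge_scale_left: "wedge (form_scale c \<eta>) \<zeta> Vs x = c * wedge \<eta> \<zeta> Vs x"
  unfolding form_scale_def by (rule wedge_mult_left)

lemma wedge_scale_right: "wedge \<eta> (form_scale c \<zeta>) Vs x = c * wedge \<eta> \<zeta> Vs x"
  unfolding form_scale_def by (rule wedge_mult_right)

lemmas wedge_bilinear = wedge_add_left wedge_add_right wedge_scale_left wedge_scale_right

lemma wedge_Cons:
  "wedge \<eta> \<zeta> (V # Vs) x =
    wedge (interior_product V \<eta>) \<zeta> Vs x + wedge (form_hat \<eta>) (interior_product V \<zeta>) Vs x"
  using fun_cong[OF fun_cong[OF interior_product_wedge[of V \<eta> \<zeta>], of Vs], of x]
  by (simp add: interior_product_def form_add_def)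

section \<open>Sections and the anchor of a Lie algebroid\<close>

locale algebroid =
  fixes A :: "('m::{t2_space,second_countable_topology}, 'b::real_normed_vector) atlas"
    and E :: "('m, 'e, 'f::real_normed_vector) vbundle"
    and br :: "('m \<Rightarrow> 'e) \<Rightarrow> ('m \<Rightarrow> 'e) \<Rightarrow> 'm \<Rightarrow> 'e"
    and \<rho> :: "'e \<Rightarrow> 'm tangent"
  assumes lie_algebroid: "lie_algebroid A E br \<rho>"
begin

abbreviation "C \<equiv> smooth_functions A"
abbreviation "S \<equiv> smooth_sections A E"
abbreviation "D V \<equiv> vf_apply (\<rho> \<circ> V)"

section \<open>Charts and smooth maps on the base\<close>

lemma smooth_manifold: "smooth_manifold A"
  and smooth_vector_bundle: "smooth_vector_bundle A E"
  and lie_algebra: "lie_algebra_on_sections A E br"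
  and smooth_anchor: "smooth_bundle_map A E (tangent_bundle A) \<rho>"
  using lie_algebroid by (simp_all add: lie_algebroid_def)

lemma finite_dim_base: "finite_dim TYPE('b)"
  using smooth_manifold by (simp add: smooth_manifold_def)

lemma finite_dim_fibre: "finite_dim TYPE('f)"
  using smooth_vector_bundle by (simp add: smooth_vector_bundle_def)

lemma chart_homeomorphism:
  assumes "(U, \<phi>) \<in> A"
  shows "open U \<and> open (\<phi> ` U) \<and> homeomorphism U (\<phi> ` U) \<phi> (inv_into U \<phi>)"
proof -
  have "\<forall>(U, \<phi>)\<in>A. open U \<and> open (\<phi> ` U) \<and> homeomorphism U (\<phi> ` U) \<phi> (inv_into U \<phi>)"
    using smooth_manifold unfolding smooth_manifold_def by (elim conjE)
  from bspec[OF this assms] show ?thesis by simp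
qed

lemma open_chart_image:
  assumes "(U, \<phi>) \<in> A" "open W"
  shows "open (\<phi> ` (U \<inter> W))"
proof -
  have "openin (top_of_set U) (U \<inter> W)"
    using assms(2) by (rule openin_open_Int)
  then have "openin (top_of_set (\<phi> ` U)) (\<phi> ` (U \<inter> W))"
    using chart_homeomorphism[OF assms(1)] homeomorphism_imp_open_map by blast
  then show ?thesis
    using chart_homeomorphism[OF assms(1)] openin_open_trans by blast
qed

lemma chart_inverse: "(U, \<phi>) \<in> A \<Longrightarrow> x \<in> U \<Longrightarrow> inv_into U \<phi> (\<phi> x) = x"
  using chart_homeomorphism homeomorphism_apply1 by blast

lemma smooth_map_onI:
  "(\<And>U \<phi>. (U, \<phi>) \<in> A \<Longrightarrow> smooth_on (\<phi> ` (U \<inter> W)) (\<lambda>y. f (inv_into U \<phi> y))) \<Longrightarrow> smooth_map_on A W f"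
  by (simp add: smooth_map_on_def o_def split_beta)

lemma smooth_map_onD:
  "smooth_map_on A W f \<Longrightarrow> (U, \<phi>) \<in> A \<Longrightarrow> smooth_on (\<phi> ` (U \<inter> W)) (\<lambda>y. f (inv_into U \<phi> y))"
  using bspec[of A "\<lambda>(U, \<phi>). smooth_on (\<phi> ` (U \<inter> W)) (f \<circ> inv_into U \<phi>)" "(U, \<phi>)"]
  by (simp add: smooth_map_on_def o_def)

lemma smooth_map_on_const: "smooth_map_on A W (\<lambda>x. c)"
  by (intro smooth_map_onI smooth_on_const)

lemma smooth_map_on_add:
  assumes "open W" "smooth_map_on A W f" "smooth_map_on A W g"
  shows "smooth_map_on A W (\<lambda>x. f x + g x)"
  by (rule smooth_map_onI) (simp add: smooth_on_add open_chart_image smooth_map_onD assms)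

lemma smooth_map_on_scaleR:
  fixes f :: "'m \<Rightarrow> real"
  assumes "open W" "smooth_map_on A W f" "smooth_map_on A W g"
  shows "smooth_map_on A W (\<lambda>x. f x *\<^sub>R g x)"
  by (rule smooth_map_onI) (simp add: smooth_on_scaleR open_chart_image smooth_map_onD assms)

lemma smooth_map_on_subset: "W \<subseteq> W' \<Longrightarrow> smooth_map_on A W' f \<Longrightarrow> smooth_map_on A W f"
  by (rule smooth_map_onI, rule smooth_on_subset[OF _ smooth_map_onD[of W']]) auto

lemma smooth_const: "(\<lambda>x. c) \<in> C"
  by (simp add: smooth_functions_def smooth_map_on_const)

lemma smooth_add: "f \<in> C \<Longrightarrow> g \<in> C \<Longrightarrow> (\<lambda>x. f x + g x) \<in> C"
  by (simp add: smooth_functions_def smooth_map_on_add)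

lemma smooth_mult: "f \<in> C \<Longrightarrow> g \<in> C \<Longrightarrow> (\<lambda>x. f x * g x) \<in> C"
  using smooth_map_on_scaleR[of UNIV f g] by (simp add: smooth_functions_def)

lemma smooth_minus: "f \<in> C \<Longrightarrow> (\<lambda>x. - f x) \<in> C"
  using smooth_mult[OF smooth_const[of "-1"]] by simp

lemma smooth_diff: "f \<in> C \<Longrightarrow> g \<in> C \<Longrightarrow> (\<lambda>x. f x - g x) \<in> C"
  using smooth_add[OF _ smooth_minus] by simp

lemma smooth_sum: "(\<And>i. i \<in> I \<Longrightarrow> f i \<in> C) \<Longrightarrow> (\<lambda>x. \<Sum>i\<in>I. f i x) \<in> C"
  by (induction I rule: infinite_finite_induct) (auto simp: smooth_const smooth_add)

section \<open>Fibres and sections in bundle charts\<close>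

lemma bundle_chart_exists: "\<exists>(W, \<beta>)\<in>vb_charts E. x \<in> W"
proof -
  have "(\<Union>(W, \<beta>)\<in>vb_charts E. W) = UNIV"
    using smooth_vector_bundle unfolding smooth_vector_bundle_def by (elim conjE)
  then show ?thesis by blast
qed

lemma bundle_chart:
  assumes "(W, \<beta>) \<in> vb_charts E"
  shows "open W"
    and "x \<in> W \<Longrightarrow> bij_betw (\<beta> x) UNIV (fibre E x)"
    and "x \<in> W \<Longrightarrow> \<beta> x (u + v) = vb_add E (\<beta> x u) (\<beta> x v)"
    and "x \<in> W \<Longrightarrow> \<beta> x (c *\<^sub>R v) = vb_scale E c (\<beta> x v)"
    and "x \<in> W \<Longrightarrow> \<beta> x 0 = vb_zero E x"
proof -
  have "\<forall>(W, \<beta>)\<in>vb_charts E. open W \<and> (\<forall>x\<in>W. bij_betw (\<beta> x) UNIV (fibre E x) \<and>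
      (\<forall>u v. \<beta> x (u + v) = vb_add E (\<beta> x u) (\<beta> x v)) \<and>
      (\<forall>c v. \<beta> x (c *\<^sub>R v) = vb_scale E c (\<beta> x v)) \<and> \<beta> x 0 = vb_zero E x)"
    using smooth_vector_bundle unfolding smooth_vector_bundle_def by (elim conjE)
  from bspec[OF this assms] show "open W"
    and "x \<in> W \<Longrightarrow> bij_betw (\<beta> x) UNIV (fibre E x)"
    and "x \<in> W \<Longrightarrow> \<beta> x (u + v) = vb_add E (\<beta> x u) (\<beta> x v)"
    and "x \<in> W \<Longrightarrow> \<beta> x (c *\<^sub>R v) = vb_scale E c (\<beta> x v)"
    and "x \<in> W \<Longrightarrow> \<beta> x 0 = vb_zero E x"
    by simp_all
qed

lemma chart_in_fibre: "(W, \<beta>) \<in> vb_charts E \<Longrightarrow> x \<in> W \<Longrightarrow> \<beta> x v \<in> fibre E x"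
  using bundle_chart(2) by (metis bij_betwE UNIV_I)

lemma fibre_ops:
  assumes "e \<in> fibre E x" "e' \<in> fibre E x"
  shows "vb_add E e e' \<in> fibre E x" "vb_scale E c e \<in> fibre E x"
proof -
  obtain W \<beta> where \<beta>: "(W, \<beta>) \<in> vb_charts E" "x \<in> W"
    using bundle_chart_exists by blast
  obtain u v where uv: "e = \<beta> x u" "e' = \<beta> x v"
    using assms bundle_chart(2)[OF \<beta>] by (metis bij_betw_iff_bijections)
  show "vb_add E e e' \<in> fibre E x" "vb_scale E c e \<in> fibre E x"
    unfolding uv using bundle_chart(3,4)[OF \<beta>] chart_in_fibre[OF \<beta>] by metis+
qed

lemma section_in_fibre: "V \<in> S \<Longrightarrow> V x \<in> fibre E x"
  by (simp add: smooth_sections_def)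

lemma section_coords:
  assumes "V \<in> S" "(W, \<beta>) \<in> vb_charts E"
  obtains a where "smooth_map_on A W a" "\<And>x. x \<in> W \<Longrightarrow> V x = \<beta> x (a x)"
proof -
  have "\<forall>(W, \<beta>)\<in>vb_charts E. \<exists>a. smooth_map_on A W a \<and> (\<forall>x\<in>W. V x = \<beta> x (a x))"
    using assms(1) by (simp add: smooth_sections_def)
  from bspec[OF this assms(2)] show thesis
    using that by auto
qed

lemma sec_add_in: 
  assumes "s \<in> S" "t \<in> S"
  shows "sec_add E s t \<in> S"
  unfolding smooth_sections_def
proof (intro CollectI conjI allI ballI, goal_cases)
  case (1 x)
  then show ?case
    by (simp add: sec_add_def fibre_ops section_in_fibre assms)
next
  case (2 c)
  obtain W \<beta> where c: "c = (W, \<beta>)" by fastforce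
  with 2 have \<beta>: "(W, \<beta>) \<in> vb_charts E" by simp
  obtain a where a: "smooth_map_on A W a" "\<And>x. x \<in> W \<Longrightarrow> s x = \<beta> x (a x)"
    using section_coords[OF assms(1) \<beta>] by blast
  obtain b where b: "smooth_map_on A W b" "\<And>x. x \<in> W \<Longrightarrow> t x = \<beta> x (b x)"
    using section_coords[OF assms(2) \<beta>] by blast
  have "smooth_map_on A W (\<lambda>x. a x + b x)"
    by (intro smooth_map_on_add bundle_chart(1)[OF \<beta>] a b)
  moreover have "sec_add E s t x = \<beta> x (a x + b x)" if "x \<in> W" for x
    using that by (simp add: sec_add_def a b bundle_chart(3)[OF \<beta>])
  ultimately show ?case
    unfolding c by auto
qed

lemma sec_scale_in: 
  assumes "f \<in> C" "s \<in> S"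
  shows "sec_scale E f s \<in> S"
  unfolding smooth_sections_def
proof (intro CollectI conjI allI ballI, goal_cases)
  case (1 x)
  then show ?case
    using fibre_ops(2)[OF section_in_fibre section_in_fibre] assms
    by (simp add: sec_scale_def)
next
  case (2 c)
  obtain W \<beta> where c: "c = (W, \<beta>)" by fastforce
  with 2 have \<beta>: "(W, \<beta>) \<in> vb_charts E" by simp
  obtain a where a: "smooth_map_on A W a" "\<And>x. x \<in> W \<Longrightarrow> s x = \<beta> x (a x)"
    using section_coords[OF assms(2) \<beta>] by blast
  have "smooth_map_on A W f"
    using assms(1) smooth_map_on_subset[of W UNIV f] by (simp add: smooth_functions_def)
  then have "smooth_map_on A W (\<lambda>x. f x *\<^sub>R a x)"
    by (intro smooth_map_on_scaleR bundle_chart(1)[OF \<beta>] a)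
  moreover have "sec_scale E f s x = \<beta> x (f x *\<^sub>R a x)" if "x \<in> W" for x
    using that by (simp add: sec_scale_def a bundle_chart(4)[OF \<beta>])
  ultimately show ?case
    unfolding c by auto
qed

text \<open>Written as a multiple of a section, the zero section becomes accessible to homogeneity,
  which shows that forms vanish on it.\<close>

lemma vb_zero_eq_sec_scale:
  assumes "s \<in> S"
  shows "vb_zero E = sec_scale E (\<lambda>_. 0) s"
proof
  fix x
  obtain W \<beta> where \<beta>: "(W, \<beta>) \<in> vb_charts E" "x \<in> W"
    using bundle_chart_exists by blast
  obtain a where "s x = \<beta> x (a x)"
    using section_coords[OF assms \<beta>(1)] \<beta>(2) by blast
  then show "vb_zero E x = sec_scale E (\<lambda>_. 0) s x"
    using bundle_chart(4)[OF \<beta>, of 0 "a x"] bundle_chart(5)[OF \<beta>] by (simp add: sec_scale_def)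
qed

section \<open>Bracket and anchor\<close>

lemma br_in: "s \<in> S \<Longrightarrow> t \<in> S \<Longrightarrow> br s t \<in> S"
  and br_add_left: "s \<in> S \<Longrightarrow> t \<in> S \<Longrightarrow> u \<in> S \<Longrightarrow>
    br (sec_add E s t) u = sec_add E (br s u) (br t u)"
  and br_add_right: "s \<in> S \<Longrightarrow> t \<in> S \<Longrightarrow> u \<in> S \<Longrightarrow>
    br s (sec_add E t u) = sec_add E (br s t) (br s u)"
  and br_self: "s \<in> S \<Longrightarrow> br s s = vb_zero E"
  and br_jacobi: "s \<in> S \<Longrightarrow> t \<in> S \<Longrightarrow> u \<in> S \<Longrightarrow>
    sec_add E (br s (br t u)) (sec_add E (br t (br u s)) (br u (br s t))) = vb_zero E"
  using lie_algebra unfolding lie_algebra_on_sections_def Let_def by simp_all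

lemma br_scale_right: "s \<in> S \<Longrightarrow> t \<in> S \<Longrightarrow> f \<in> C \<Longrightarrow>
    br s (sec_scale E f t) = sec_add E (sec_scale E f (br s t)) (sec_scale E (D s f) t)"
  using lie_algebroid unfolding lie_algebroid_def by simp

lemma anchor_br: "s \<in> S \<Longrightarrow> t \<in> S \<Longrightarrow> \<rho> \<circ> br s t = vf_bracket A (\<rho> \<circ> s) (\<rho> \<circ> t)"
  using lie_algebroid unfolding lie_algebroid_def by simp

lemma anchor_maps:
  shows "\<forall>x. \<forall>e\<in>fibre E x. \<rho> e \<in> fibre (tangent_bundle A) x"
    and "\<forall>x. \<forall>e\<in>fibre E x. \<forall>e'\<in>fibre E x.
      \<rho> (vb_add E e e') = vb_add (tangent_bundle A) (\<rho> e) (\<rho> e')"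
    and "\<forall>c. \<forall>e\<in>vb_total E. \<rho> (vb_scale E c e) = vb_scale (tangent_bundle A) c (\<rho> e)"
    and "\<forall>(W, \<beta>)\<in>vb_charts E. \<forall>(W', \<beta>')\<in>vb_charts (tangent_bundle A). \<forall>v.
      \<exists>a. smooth_map_on A (W \<inter> W') a \<and> (\<forall>x\<in>W \<inter> W'. \<rho> (\<beta> x v) = \<beta>' x (a x))"
  using smooth_anchor unfolding smooth_bundle_map_def by - (elim conjE, assumption)+

lemma anchor_fibre:
  assumes "e \<in> fibre E x"
  shows "snd (\<rho> e) \<in> tangent_space A x"
proof -
  have "\<rho> e \<in> fibre (tangent_bundle A) x"
    using anchor_maps(1) assms by blast
  then show ?thesis
    by (auto simp: fibre_def tangent_bundle_def)
qed

lemma anchor_add: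
  assumes "e \<in> fibre E x" "e' \<in> fibre E x"
  shows "snd (\<rho> (vb_add E e e')) f = snd (\<rho> e) f + snd (\<rho> e') f"
proof -
  have "\<rho> (vb_add E e e') = vb_add (tangent_bundle A) (\<rho> e) (\<rho> e')"
    using anchor_maps(2) assms by blast
  then show ?thesis
    by (simp add: tangent_bundle_def split_beta)
qed

lemma anchor_scale:
  assumes "e \<in> fibre E x"
  shows "snd (\<rho> (vb_scale E c e)) f = c * snd (\<rho> e) f"
proof -
  have "e \<in> vb_total E"
    using assms by (simp add: fibre_def)
  then have "\<rho> (vb_scale E c e) = vb_scale (tangent_bundle A) c (\<rho> e)"
    using anchor_maps(3) by blast
  then show ?thesis
    by (simp add: tangent_bundle_def split_beta)
qed

section \<open>Differentiation of functions along anchored sections\<close>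

lemma D_sec_add: "s \<in> S \<Longrightarrow> t \<in> S \<Longrightarrow> D (sec_add E s t) f x = D s f x + D t f x"
  by (simp add: vf_apply_def sec_add_def anchor_add[OF section_in_fibre section_in_fibre])

lemma D_sec_scale: "s \<in> S \<Longrightarrow> D (sec_scale E g s) f x = g x * D s f x"
  by (simp add: vf_apply_def sec_scale_def anchor_scale[OF section_in_fibre])

lemma D_tangent: "V \<in> S \<Longrightarrow> snd (\<rho> (V x)) \<in> tangent_space A x"
  using anchor_fibre section_in_fibre by blast

lemma D_add: "V \<in> S \<Longrightarrow> f \<in> C \<Longrightarrow> g \<in> C \<Longrightarrow> D V (\<lambda>x. f x + g x) = (\<lambda>x. D V f x + D V g x)"
  by (rule ext) (use D_tangent[of V] in \<open>simp add: vf_apply_def tangent_space_def\<close>)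

lemma D_mult: "V \<in> S \<Longrightarrow> f \<in> C \<Longrightarrow> g \<in> C \<Longrightarrow>
    D V (\<lambda>x. f x * g x) = (\<lambda>x. f x * D V g x + g x * D V f x)"
  by (rule ext) (use D_tangent[of V] in \<open>simp add: vf_apply_def tangent_space_def\<close>)

lemma D_scale: "V \<in> S \<Longrightarrow> f \<in> C \<Longrightarrow> D V (\<lambda>x. c * f x) = (\<lambda>x. c * D V f x)"
  by (rule ext) (use D_tangent[of V] in \<open>simp add: vf_apply_def tangent_space_def\<close>)

lemma D_zero: "V \<in> S \<Longrightarrow> D V (\<lambda>x. 0) = (\<lambda>x. 0)"
  using D_scale[OF _ smooth_const, of V 0 0] by simp

lemma D_br:
  assumes "V \<in> S" "W \<in> S" "f \<in> C"
  shows "D (br V W) f x = D V (D W f) x - D W (D V f) x"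
proof -
  have "D (br V W) f x = snd (vf_bracket A (\<rho> \<circ> V) (\<rho> \<circ> W) x) f"
    by (simp only: anchor_br assms vf_apply_def[of "vf_bracket A (\<rho> \<circ> V) (\<rho> \<circ> W)"])
  then show ?thesis
    using assms(3) by (simp add: vf_bracket_def)
qed

text \<open>Smoothness of the section, of the anchor and of derivatives is given for coefficients or
  for one fixed vector at a time. Expanding in bases of both model spaces turns the derivative into
  a finite sum of products of such data: coordinates of \<open>V\<close>, coordinates of the
  anchored basis vectors, and directional derivatives of \<open>f\<close>.\<close>

lemma D_smooth:
  assumes "V \<in> S" "f \<in> C"
  shows "D V f \<in> C"
  unfolding smooth_functions_def mem_Collect_eq
proof (rule smooth_map_onI)
  fix U \<phi> assume U: "(U, \<phi>) \<in> A"
  let ?g = "f \<circ> inv_into U \<phi>"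
  obtain B and c :: "'f \<Rightarrow> 'f \<Rightarrow> real" where "finite B" and c: "\<And>b. bounded_linear (c b)"
    "\<And>v. v = (\<Sum>b\<in>B. c b v *\<^sub>R b)"
    using finite_dim_coordinates[OF finite_dim_fibre] by blast
  obtain B' and c' :: "'b \<Rightarrow> 'b \<Rightarrow> real" where "finite B'" and c': "\<And>b. bounded_linear (c' b)"
    "\<And>v. v = (\<Sum>b\<in>B'. c' b v *\<^sub>R b)"
    using finite_dim_coordinates[OF finite_dim_base] by blast
  have g: "smooth_on (\<phi> ` U) ?g"
    using smooth_map_onD[of UNIV f, OF _ U] assms(2) by (simp add: smooth_functions_def o_def)
  show "smooth_on (\<phi> ` (U \<inter> UNIV)) (\<lambda>y. D V f (inv_into U \<phi> y))"
  \<comment> \<open>Coordinates of \<open>V\<close> exist only over the domain of a bundle chart,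
    which need not contain \<open>U\<close>.\<close>
  proof (rule smooth_on_local)
    fix y assume "y \<in> \<phi> ` (U \<inter> UNIV)"
    then obtain x where x: "x \<in> U" "y = \<phi> x" by auto
    obtain W \<beta> where \<beta>: "(W, \<beta>) \<in> vb_charts E" "x \<in> W"
      using bundle_chart_exists by blast
    obtain a where a: "smooth_map_on A W a" "\<And>x. x \<in> W \<Longrightarrow> V x = \<beta> x (a x)"
      using section_coords[OF assms(1) \<beta>(1)] by blast
    let ?T = "\<phi> ` (U \<inter> W)"
    have opT: "open ?T"
      using open_chart_image[OF U bundle_chart(1)[OF \<beta>(1)]] .
    \<comment> \<open>The tangent chart induced by the same \<phi> is chosen, so that coordinate
      vectors act as Frechet derivatives of \<open>?g\<close>.\<close>
    have "(U, \<lambda>x w. (x, coord_vector A U \<phi> x w)) \<in> vb_charts (tangent_bundle A)"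
      using U by (force simp: tangent_bundle_def)
    then have "\<exists>\<alpha>. smooth_map_on A (W \<inter> U) \<alpha> \<and>
        (\<forall>x\<in>W \<inter> U. \<rho> (\<beta> x v) = (x, coord_vector A U \<phi> x (\<alpha> x)))" for v
      using bspec[OF anchor_maps(4) \<beta>(1)] by fast
    then obtain \<alpha> where \<alpha>: "\<And>v. smooth_map_on A (W \<inter> U) (\<alpha> v)"
      "\<And>v x. x \<in> W \<inter> U \<Longrightarrow> \<rho> (\<beta> x v) = (x, coord_vector A U \<phi> x (\<alpha> v x))"
      by metis
    have D_eq: "D V f z = (\<Sum>b\<in>B. c b (a z) *
        (\<Sum>b'\<in>B'. c' b' (\<alpha> b z) * frechet_derivative ?g (at (\<phi> z)) b'))"
      if z: "z \<in> U" "z \<in> W" for z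
    proof -
      have lin: "linear (\<lambda>v. snd (\<rho> (\<beta> z v)) f)"
        using bundle_chart(3,4)[OF \<beta>(1) z(2)] chart_in_fibre[OF \<beta>(1) z(2)]
        by (intro linearI) (simp_all add: anchor_add[of _ z] anchor_scale[of _ z])
      have "D V f z = snd (\<rho> (\<beta> z (a z))) f"
        using a(2)[OF z(2)] by (simp add: vf_apply_def)
      also have "\<dots> = (\<Sum>b\<in>B. c b (a z) * snd (\<rho> (\<beta> z b)) f)"
        using arg_cong[OF c(2)[of "a z"], of "\<lambda>v. snd (\<rho> (\<beta> z v)) f"]
          linear_sum[OF lin, of "\<lambda>b. c b (a z) *\<^sub>R b" B] linear_scale[OF lin]
        by simp
      finally have D_eq: "D V f z = (\<Sum>b\<in>B. c b (a z) * snd (\<rho> (\<beta> z b)) f)" .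
      have "snd (\<rho> (\<beta> z b)) f =
          (\<Sum>b'\<in>B'. c' b' (\<alpha> b z) * frechet_derivative ?g (at (\<phi> z)) b')" for b
      proof -
        have lin': "linear (frechet_derivative ?g (at (\<phi> z)))"
          using smooth_on_differentiable[OF g] z by (intro linear_frechet_derivative) auto
        have "snd (\<rho> (\<beta> z b)) f = frechet_derivative ?g (at (\<phi> z)) (\<alpha> b z)"
          using \<alpha>(2)[of z b] z assms(2) by (simp add: coord_vector_def)
        then show ?thesis
          using arg_cong[OF c'(2)[of "\<alpha> b z"], of "frechet_derivative ?g (at (\<phi> z))"]
            linear_sum[OF lin', of "\<lambda>b'. c' b' (\<alpha> b z) *\<^sub>R b'" B'] linear_scale[OF lin']
          by simp
      qed
      then show ?thesis
        by (simp only: D_eq)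
    qed
    have aT: "smooth_on ?T (\<lambda>y. a (inv_into U \<phi> y))"
      using smooth_map_onD[OF a(1) U] .
    have \<alpha>T: "smooth_on ?T (\<lambda>y. \<alpha> b (inv_into U \<phi> y))" for b
    proof -
      have "smooth_on (\<phi> ` (U \<inter> (W \<inter> U))) (\<lambda>y. \<alpha> b (inv_into U \<phi> y))"
        using smooth_map_onD[OF \<alpha>(1) U] .
      moreover have "U \<inter> (W \<inter> U) = U \<inter> W" by blast
      ultimately show ?thesis by simp
    qed
    have gT: "smooth_on ?T (\<lambda>y. frechet_derivative ?g (at y) b')" for b'
      using smooth_on_frechet_derivative[OF g] by (rule smooth_on_subset[rotated]) auto
    have "smooth_on ?T (\<lambda>y. \<Sum>b\<in>B. c b (a (inv_into U \<phi> y)) *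
        (\<Sum>b'\<in>B'. c' b' (\<alpha> b (inv_into U \<phi> y)) * frechet_derivative ?g (at y) b'))"
      by (intro smooth_on_sum smooth_on_mult opT smooth_on_bounded_linear[OF opT c(1)]
          smooth_on_bounded_linear[OF opT c'(1)] aT \<alpha>T gT)
    then have "smooth_on ?T (\<lambda>y. D V f (inv_into U \<phi> y))"
      by (rule smooth_on_cong[OF opT, rotated]) (auto simp: D_eq chart_inverse[OF U])
    then show "\<exists>T. open T \<and> y \<in> T \<and> smooth_on T (\<lambda>y. D V f (inv_into U \<phi> y))"
      using opT x \<beta>(2) by blast
  qed
qed

subsection \<open>Cartan calculus\<close>

abbreviation "L \<equiv> lie_derivative A E br \<rho>"
abbreviation "d \<equiv> ext_derivative A E br \<rho>"
abbreviation "ip \<equiv> interior_product"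

text \<open>
  Forms without a bound on the degree: skew-symmetry is imposed on adjacent entries and linearity on
  the first entry only, so that \<open>alt_form \<omega>\<close> is easily checked by induction on lists through
  \<open>ip V \<omega>\<close>.
\<close>

definition alt_form :: "('m, 'e) form \<Rightarrow> bool" where
  "alt_form \<omega> \<longleftrightarrow>
    (\<forall>Vs. \<not> set Vs \<subseteq> S \<longrightarrow> \<omega> Vs = (\<lambda>x. 0)) \<and>
    (\<forall>Vs. \<omega> Vs \<in> C) \<and>
    (\<forall>s\<in>S. \<forall>t\<in>S. \<forall>Vs x. \<omega> (sec_add E s t # Vs) x = \<omega> (s # Vs) x + \<omega> (t # Vs) x) \<and>
    (\<forall>f\<in>C. \<forall>s\<in>S. \<forall>Vs x. \<omega> (sec_scale E f s # Vs) x = f x * \<omega> (s # Vs) x) \<and>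
    (\<forall>Us a b Vs x. \<omega> (Us @ a # b # Vs) x = - \<omega> (Us @ b # a # Vs) x)"

lemma alt_formD:
  assumes "alt_form \<omega>"
  shows alt_zero: "\<not> set Vs \<subseteq> S \<Longrightarrow> \<omega> Vs = (\<lambda>x. 0)"
    and alt_smooth: "\<omega> Vs \<in> C"
    and alt_add: "s \<in> S \<Longrightarrow> t \<in> S \<Longrightarrow> \<omega> (sec_add E s t # Vs) x = \<omega> (s # Vs) x + \<omega> (t # Vs) x"
    and alt_scale: "f \<in> C \<Longrightarrow> s \<in> S \<Longrightarrow> \<omega> (sec_scale E f s # Vs) x = f x * \<omega> (s # Vs) x"
    and alt_swap: "\<omega> (Us @ a # b # Vs) x = - \<omega> (Us @ b # a # Vs) x"
proof -
  note * = assms[unfolded alt_form_def]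
  show "\<not> set Vs \<subseteq> S \<Longrightarrow> \<omega> Vs = (\<lambda>x. 0)"
    by (rule *[THEN conjunct1, rule_format])
  show "\<omega> Vs \<in> C"
    by (rule *[THEN conjunct2, THEN conjunct1, rule_format])
  show "s \<in> S \<Longrightarrow> t \<in> S \<Longrightarrow> \<omega> (sec_add E s t # Vs) x = \<omega> (s # Vs) x + \<omega> (t # Vs) x"
    by (rule *[THEN conjunct2, THEN conjunct2, THEN conjunct1, rule_format])
  show "f \<in> C \<Longrightarrow> s \<in> S \<Longrightarrow> \<omega> (sec_scale E f s # Vs) x = f x * \<omega> (s # Vs) x"
    by (rule *[THEN conjunct2, THEN conjunct2, THEN conjunct2, THEN conjunct1, rule_format])
  show "\<omega> (Us @ a # b # Vs) x = - \<omega> (Us @ b # a # Vs) x"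
    by (rule *[THEN conjunct2, THEN conjunct2, THEN conjunct2, THEN conjunct2, rule_format])
qed

text \<open>The conditions have to be checked on tuples of sections only: elsewhere both sides
  vanish by the first assumption.\<close>

lemma alt_formI:
  assumes "\<And>Vs. \<not> set Vs \<subseteq> S \<Longrightarrow> \<omega> Vs = (\<lambda>x. 0)"
    and "\<And>Vs. set Vs \<subseteq> S \<Longrightarrow> \<omega> Vs \<in> C"
    and "\<And>s t Vs x. s \<in> S \<Longrightarrow> t \<in> S \<Longrightarrow> set Vs \<subseteq> S \<Longrightarrow>
      \<omega> (sec_add E s t # Vs) x = \<omega> (s # Vs) x + \<omega> (t # Vs) x"
    and "\<And>f s Vs x. f \<in> C \<Longrightarrow> s \<in> S \<Longrightarrow> set Vs \<subseteq> S \<Longrightarrow>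
      \<omega> (sec_scale E f s # Vs) x = f x * \<omega> (s # Vs) x"
    and "\<And>Us a b Vs x. set (Us @ a # b # Vs) \<subseteq> S \<Longrightarrow> \<omega> (Us @ a # b # Vs) x = - \<omega> (Us @ b # a # Vs) x"
  shows "alt_form \<omega>"
proof -
  have zero: "\<omega> (U # Vs) x = 0" if "\<not> set Vs \<subseteq> S" for U Vs x
    using assms(1)[of "U # Vs"] that by simp
  have "\<omega> Vs \<in> C" for Vs
    using assms(1,2)[of Vs] smooth_const[of 0] by (cases "set Vs \<subseteq> S") auto
  moreover have "\<omega> (sec_add E s t # Vs) x = \<omega> (s # Vs) x + \<omega> (t # Vs) x"
    if "s \<in> S" "t \<in> S" for s t Vs x
    using assms(3)[OF that, of Vs x] zero[of Vs] by (cases "set Vs \<subseteq> S") simp_all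
  moreover have "\<omega> (sec_scale E f s # Vs) x = f x * \<omega> (s # Vs) x"
    if "f \<in> C" "s \<in> S" for f s Vs x
    using assms(4)[OF that, of Vs x] zero[of Vs] by (cases "set Vs \<subseteq> S") simp_all
  moreover have "\<omega> (Us @ a # b # Vs) x = - \<omega> (Us @ b # a # Vs) x" for Us a b Vs x
  proof (cases "set (Us @ a # b # Vs) \<subseteq> S")
    case False
    then have "\<not> set (Us @ b # a # Vs) \<subseteq> S" by auto
    from assms(1)[OF False] assms(1)[OF this] show ?thesis by simp
  qed (rule assms(5))
  ultimately show ?thesis
    unfolding alt_form_def using assms(1) by (intro conjI allI ballI impI)
qed

lemma alt_swap_head: "alt_form \<omega> \<Longrightarrow> \<omega> (a # b # Vs) x = - \<omega> (b # a # Vs) x"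
  using alt_swap[of \<omega> "[]" a b Vs x] by simp

lemma alt_form_scale:
  assumes "alt_form \<eta>"
  shows "alt_form (form_scale c \<eta>)"
proof (rule alt_formI)
  show "form_scale c \<eta> (Us @ a # b # Vs) x = - form_scale c \<eta> (Us @ b # a # Vs) x" for Us a b Vs x
    using alt_swap[OF assms, of Us a b Vs x] by (simp add: form_scale_def)
qed (simp_all add: form_scale_def alt_zero[OF assms] alt_smooth[OF assms]
    alt_add[OF assms] alt_scale[OF assms] smooth_mult[OF smooth_const] distrib_left mult.left_commute)

lemma alt_form_hat:
  assumes "alt_form \<eta>"
  shows "alt_form (form_hat \<eta>)"
proof (rule alt_formI)
  show "form_hat \<eta> (Us @ a # b # Vs) x = - form_hat \<eta> (Us @ b # a # Vs) x" for Us a b Vs x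
    using alt_swap[OF assms, of Us a b Vs x] by (simp add: form_hat_def)
qed (simp_all add: form_hat_def alt_zero[OF assms] alt_smooth[OF assms]
    alt_add[OF assms] alt_scale[OF assms] smooth_mult[OF smooth_const]
    smooth_minus distrib_left mult.left_commute)

text \<open>The head of the contracted form is the second entry of \<omega>; exchanging it with
  \<open>V\<close> reduces linearity there to linearity in the first entry.\<close>

lemma alt_ip:
  assumes "alt_form \<omega>"
  shows "alt_form (ip V \<omega>)"
proof (rule alt_formI)
  note head = alt_swap_head[OF assms, of V]
  show "ip V \<omega> Vs = (\<lambda>x. 0)" if "\<not> set Vs \<subseteq> S" for Vs
    using that by (simp add: interior_product_def alt_zero[OF assms])
  show "ip V \<omega> Vs \<in> C" for Vs
    by (simp add: interior_product_def alt_smooth[OF assms])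
  show "ip V \<omega> (sec_add E s t # Vs) x = ip V \<omega> (s # Vs) x + ip V \<omega> (t # Vs) x"
    if "s \<in> S" "t \<in> S" for s t Vs x
    using that by (simp add: interior_product_def head alt_add[OF assms])
  show "ip V \<omega> (sec_scale E f s # Vs) x = f x * ip V \<omega> (s # Vs) x"
    if "f \<in> C" "s \<in> S" for f s Vs x
    using that by (simp add: interior_product_def head alt_scale[OF assms])
  show "ip V \<omega> (Us @ a # b # Vs) x = - ip V \<omega> (Us @ b # a # Vs) x" for Us a b Vs x
    using alt_swap[OF assms, of "V # Us" a b Vs x] by (simp add: interior_product_def)
qed

lemma alt_move: "alt_form \<omega> \<Longrightarrow> \<omega> (Us @ a # Vs) x = (-1) ^ length Us * \<omega> (a # Us @ Vs) x"
proof (induction Us arbitrary: \<omega>)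
  case (Cons c Us)
  have "\<omega> ((c # Us) @ a # Vs) x = ip c \<omega> (Us @ a # Vs) x"
    by (simp add: interior_product_def)
  also have "\<dots> = (-1) ^ length Us * \<omega> (c # a # Us @ Vs) x"
    using Cons.IH[OF alt_ip[OF Cons.prems]] by (simp add: interior_product_def)
  finally show ?case
    by (simp add: alt_swap_head[OF Cons.prems, of c a])
qed simp

text \<open>Both entries are moved to the front, exchanged there and moved back. The moving signs
  depend only on positions, so they cancel and one minus sign remains.\<close>

lemma alt_swap_distant:
  assumes "alt_form \<omega>"
  shows "\<omega> (Us @ a # Vs @ b # Ws) x = - \<omega> (Us @ b # Vs @ a # Ws) x"
proof -
  have front: "\<omega> (Us @ a # Vs @ b # Ws) x = (-1) ^ length Us * ((-1) ^ length Vs' * \<omega> (a # b # Us @ Vs @ Ws) x)"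
    if "Vs' = Us @ Vs" for a b Vs'
    using alt_move[OF assms, of Us a "Vs @ b # Ws" x]
      alt_move[OF alt_ip[OF assms, of a], of "Us @ Vs" b Ws x] that
    by (simp add: interior_product_def)
  show ?thesis
    by (simp add: front[OF refl] alt_swap_head[OF assms, of a b])
qed

lemma ip_zero: "alt_form \<omega> \<Longrightarrow> V \<notin> S \<Longrightarrow> ip V \<omega> = (\<lambda>Vs x. 0)"
  using alt_zero[of \<omega> "V # Vs" for Vs] by (simp add: interior_product_def fun_eq_iff)

lemma ip_swap: "alt_form \<omega> \<Longrightarrow> ip U (ip V \<omega>) = form_scale (-1) (ip V (ip U \<omega>))"
  using alt_swap_head[of \<omega> V U] by (auto simp: interior_product_def form_scale_def fun_eq_iff)

lemma ip_sec_add: "alt_form \<omega> \<Longrightarrow> s \<in> S \<Longrightarrow> t \<in> S \<Longrightarrow>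
    ip (sec_add E s t) \<omega> = form_add (ip s \<omega>) (ip t \<omega>)"
  using alt_add[of \<omega> s t] by (simp add: interior_product_def form_add_def fun_eq_iff)

lemma ip_sec_scale: "alt_form \<omega> \<Longrightarrow> f \<in> C \<Longrightarrow> s \<in> S \<Longrightarrow>
    ip (sec_scale E f s) \<omega> = (\<lambda>Vs x. f x * ip s \<omega> Vs x)"
  using alt_scale[of \<omega> f s] by (simp add: interior_product_def fun_eq_iff)

text \<open>Polarization: the bracket of \<open>s + t\<close> with itself vanishes, and so do the
  two diagonal terms. The remaining cancellation is carried out in the model fibre, where
  subtraction is available.\<close>

lemma br_anti:
  assumes "s \<in> S" "t \<in> S"
  shows "br s t = sec_scale E (\<lambda>_. -1) (br t s)"
proof
  fix x
  obtain W \<beta> where \<beta>: "(W, \<beta>) \<in> vb_charts E" "x \<in> W"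
    using bundle_chart_exists by blast
  have coord: "\<exists>u. e = \<beta> x u" if "e \<in> fibre E x" for e
    using that bundle_chart(2)[OF \<beta>] by (metis bij_betw_iff_bijections)
  have "br s t x \<in> fibre E x" "br t s x \<in> fibre E x"
    using assms br_in section_in_fibre by blast+
  then obtain u v where uv: "br s t x = \<beta> x u" "br t s x = \<beta> x v"
    using coord by metis
  have "vb_zero E x = br (sec_add E s t) (sec_add E s t) x"
    using assms by (simp add: br_self sec_add_in)
  also have "\<dots> = vb_add E (vb_add E (\<beta> x 0) (\<beta> x v)) (vb_add E (\<beta> x u) (\<beta> x 0))"
    using assms
    by (simp add: br_add_left br_add_right sec_add_in)
      (simp add: sec_add_def br_self uv bundle_chart(5)[OF \<beta>])
  also have "\<dots> = \<beta> x (u + v)"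
    by (simp add: add.commute flip: bundle_chart(3)[OF \<beta>])
  finally have "\<beta> x (u + v) = \<beta> x 0"
    by (simp add: bundle_chart(5)[OF \<beta>])
  then have "u + v = 0"
    using bij_betw_imp_inj_on[OF bundle_chart(2)[OF \<beta>]] by (simp add: inj_eq)
  then have "u = (-1) *\<^sub>R v"
    by (simp add: eq_neg_iff_add_eq_0)
  then show "br s t x = sec_scale E (\<lambda>_. -1) (br t s) x"
    by (simp only: sec_scale_def uv bundle_chart(4)[OF \<beta>])
qed

lemma alt_br_anti: "alt_form \<omega> \<Longrightarrow> s \<in> S \<Longrightarrow> t \<in> S \<Longrightarrow> \<omega> (br s t # Vs) x = - \<omega> (br t s # Vs) x"
  by (simp add: br_anti[of s t] alt_scale[of \<omega>] smooth_const br_in)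

text \<open>The Jacobi identity in Leibniz form, saying that bracketing with \<open>br s t\<close>
  is the commutator of the two bracketings. Inside a form it becomes linear arithmetic over the
  reals.\<close>

lemma alt_jacobi:
  assumes "alt_form \<omega>" "s \<in> S" "t \<in> S" "u \<in> S"
  shows "\<omega> (br (br s t) u # Vs) x = \<omega> (br s (br t u) # Vs) x - \<omega> (br t (br s u) # Vs) x"
proof -
  have "\<omega> (vb_zero E # Vs) x = 0"
    using alt_scale[OF assms(1) smooth_const assms(2), of 0 Vs x] by (simp add: vb_zero_eq_sec_scale[OF assms(2)])
  then have "\<omega> (br s (br t u) # Vs) x + (\<omega> (br t (br u s) # Vs) x + \<omega> (br u (br s t) # Vs) x) = 0"
    using assms by (simp add: br_in sec_add_in alt_add[OF assms(1)] flip: br_jacobi[of s t u])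
  moreover have "\<omega> (br t (br u s) # Vs) x = - \<omega> (br (br u s) t # Vs) x"
    "\<omega> (br u (br s t) # Vs) x = - \<omega> (br (br s t) u # Vs) x"
    by (rule alt_br_anti[OF assms(1)], simp_all add: br_in assms)+
  moreover have "\<omega> (br t (br u s) # Vs) x = - \<omega> (br t (br s u) # Vs) x"
  proof -
    have "br t (br u s) = sec_scale E (\<lambda>_. -1) (br t (br s u))"
      using assms lie_algebra br_in unfolding lie_algebra_on_sections_def Let_def
      by (simp add: br_anti[of u s])
    then show ?thesis
      using assms by (simp add: alt_scale[OF assms(1)] smooth_const br_in)
  qed
  ultimately show ?thesis by simp
qed

section \<open>The Lie derivative\<close>

lemma L_Nil: "L V \<omega> [] x = D V (\<omega> []) x"
  by (simp add: lie_derivative_def)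

lemma L_zero: "\<not> set Vs \<subseteq> S \<Longrightarrow> L V \<omega> Vs x = 0"
  by (auto simp: lie_derivative_def)

lemma L_Cons:
  assumes "alt_form \<omega>" "U \<in> S"
  shows "L V \<omega> (U # Vs) x = L V (ip U \<omega>) Vs x - \<omega> (br V U # Vs) x"
proof (cases "set Vs \<subseteq> S")
  case True
  then show ?thesis
    using assms(2) by (simp add: lie_derivative_def interior_product_def sum.lessThan_Suc_shift del: sum.lessThan_Suc)
next
  case False
  then show ?thesis
    using alt_zero[OF assms(1), of "br V U # Vs"] by (simp add: L_zero)
qed

lemma ip_L:
  "alt_form \<omega> \<Longrightarrow> U \<in> S \<Longrightarrow>
    ip U (L V \<omega>) = form_add (L V (ip U \<omega>)) (form_scale (-1) (ip (br V U) \<omega>))"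
  by (simp add: fun_eq_iff form_add_def form_scale_def L_Cons interior_product_def[of U "L V \<omega>"]
      interior_product_def[of "br V U"])

lemma L_add:
  assumes "alt_form \<eta>" "alt_form \<zeta>" "V \<in> S"
  shows "L V (form_add \<eta> \<zeta>) Vs x = L V \<eta> Vs x + L V \<zeta> Vs x"
  using assms by (simp add: lie_derivative_def form_add_def D_add alt_smooth[OF assms(1)] alt_smooth[OF assms(2)] sum.distrib)

lemma L_mult:
  assumes "alt_form \<eta>" "V \<in> S" "f \<in> C"
  shows "L V (\<lambda>Vs x. f x * \<eta> Vs x) Vs x = f x * L V \<eta> Vs x + D V f x * \<eta> Vs x"
  using assms
  by (cases "set Vs \<subseteq> S")
    (simp_all add: lie_derivative_def D_mult alt_smooth[OF assms(1)] alt_zero[OF assms(1)] sum_distrib_left algebra_simps)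

lemma L_scale:
  assumes "alt_form \<eta>" "V \<in> S"
  shows "L V (form_scale c \<eta>) Vs x = c * L V \<eta> Vs x"
  using assms by (simp add: lie_derivative_def form_scale_def D_scale alt_smooth[OF assms(1)] sum_distrib_left algebra_simps)

lemma L_hat:
  assumes "alt_form \<eta>" "V \<in> S"
  shows "L V (form_hat \<eta>) = form_hat (L V \<eta>)"
  using assms
  by (auto simp: fun_eq_iff lie_derivative_def form_hat_def D_scale alt_smooth[OF assms(1)] sum_distrib_left right_diff_distrib)

lemma alt_L:
  assumes "V \<in> S" "alt_form \<omega>"
  shows "alt_form (L V \<omega>)"
proof (rule alt_formI)
  show "L V \<omega> Vs = (\<lambda>x. 0)" if "\<not> set Vs \<subseteq> S" for Vs
    using L_zero[OF that] by blast
  show "L V \<omega> Vs \<in> C" if "set Vs \<subseteq> S" for Vs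
    using that assms unfolding lie_derivative_def
    by (simp add: smooth_diff smooth_sum D_smooth alt_smooth[OF assms(2)])
  show "L V \<omega> (sec_add E s t # Vs) x = L V \<omega> (s # Vs) x + L V \<omega> (t # Vs) x"
    if "s \<in> S" "t \<in> S" for s t Vs x
    using that assms
    by (simp add: L_Cons sec_add_in ip_sec_add L_add alt_ip br_add_right alt_add[OF assms(2)] br_in)
  \<comment> \<open>Tensoriality is a cancellation: the term \<open>D V f\<close> from
    differentiating the coefficient is removed by the one from the Leibniz rule of the
    bracket.\<close>
  show "L V \<omega> (sec_scale E f s # Vs) x = f x * L V \<omega> (s # Vs) x"
    if "f \<in> C" "s \<in> S" for f s Vs x
  proof -
    have "L V \<omega> (sec_scale E f s # Vs) x = f x * L V (ip s \<omega>) Vs x + D V f x * ip s \<omega> Vs x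
        - \<omega> (br V (sec_scale E f s) # Vs) x"
      using that assms by (simp add: L_Cons sec_scale_in ip_sec_scale L_mult alt_ip)
    also have "\<omega> (br V (sec_scale E f s) # Vs) x = f x * \<omega> (br V s # Vs) x + D V f x * ip s \<omega> Vs x"
      using that assms
      by (simp add: br_scale_right alt_add[OF assms(2)] alt_scale[OF assms(2)] br_in sec_scale_in D_smooth interior_product_def)
    finally show ?thesis
      unfolding L_Cons[OF assms(2) that(2)] right_diff_distrib by linarith
  qed
  show "L V \<omega> (Us @ a # b # Vs) x = - L V \<omega> (Us @ b # a # Vs) x"
    if "set (Us @ a # b # Vs) \<subseteq> S" for Us a b Vs x
    using assms(2) that
  proof (induction Us arbitrary: \<omega>)
    case Nil
    then have ab: "a \<in> S" "b \<in> S" by auto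
    \<comment> \<open>Exchanging \<open>a\<close> and \<open>b\<close> also exchanges the two
      bracket terms up to sign, which leaves only the doubly contracted form to compare.\<close>
    have expand: "L V \<omega> (a # b # Vs) x = L V (ip b (ip a \<omega>)) Vs x - \<omega> (a # br V b # Vs) x
        - \<omega> (br V a # b # Vs) x" if "a \<in> S" "b \<in> S" for a b
      using that Nil(1) by (simp add: L_Cons alt_ip) (simp add: interior_product_def)
    have "L V (ip b (ip a \<omega>)) Vs x = - L V (ip a (ip b \<omega>)) Vs x"
      using assms(1) Nil(1) by (simp add: ip_swap[of \<omega> b a] L_scale alt_ip)
    then show ?case
      using alt_swap_head[OF Nil(1), of a "br V b" Vs x] alt_swap_head[OF Nil(1), of b "br V a" Vs x]
      by (simp add: expand ab)
  next
    case (Cons c Us)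
    then show ?case
      using alt_swap[OF Cons.prems(1), of "br V c # Us" a b Vs x] by (simp add: L_Cons alt_ip)
  qed
qed

text \<open>On functions this is the homomorphism property of the anchor. Contracting with
  \<open>U\<close> produces mixed terms that cancel between the two orders, while the double
  brackets combine by the Jacobi identity.\<close>

lemma L_br:
  assumes "V \<in> S" "W \<in> S" "alt_form \<omega>"
  shows "L (br V W) \<omega> Vs x = L V (L W \<omega>) Vs x - L W (L V \<omega>) Vs x"
  using assms(3)
proof (induction Vs arbitrary: \<omega>)
  case Nil
  have "L V \<omega> [] = D V (\<omega> [])" for V
    by (simp add: L_Nil fun_eq_iff)
  then show ?case
    using assms Nil by (simp add: L_Nil D_br alt_smooth[OF Nil])
next
  case (Cons U Vs)
  show ?case
  proof (cases "U \<in> S")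
    case True
    have expand: "L V (L W \<omega>) (U # Vs) x =
        L V (L W (ip U \<omega>)) Vs x - L V (ip (br W U) \<omega>) Vs x
        - (L W (ip (br V U) \<omega>) Vs x - \<omega> (br W (br V U) # Vs) x)"
      if "V \<in> S" "W \<in> S" for V W
      using that Cons.prems True
      by (simp add: L_Cons alt_L br_in ip_L L_add L_scale alt_ip alt_form_scale)
    have jac: "\<omega> (br (br V W) U # Vs) x = \<omega> (br V (br W U) # Vs) x - \<omega> (br W (br V U) # Vs) x"
      using alt_jacobi[OF Cons.prems assms(1,2) True] .
    show ?thesis
      unfolding expand[OF assms(1,2)] expand[OF assms(2,1)]
      using Cons.IH[OF alt_ip[OF Cons.prems], of U] jac by (simp add: L_Cons[OF Cons.prems True])
  qed (simp add: L_zero)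
qed

section \<open>The exterior derivative\<close>

lemma d_Nil: "d \<omega> [] x = 0"
  by (simp add: ext_derivative_def)

lemma d_zero: "\<not> set Vs \<subseteq> S \<Longrightarrow> d \<omega> Vs x = 0"
  by (auto simp: ext_derivative_def)

text \<open>The summands in which \<open>V\<close> is differentiated along or enters the bracket add
  up to the Lie derivative. In all others \<open>V\<close> stays an argument: in the first sum the
  index shifts by one, in the second \<open>V\<close> has to be exchanged with the bracket, and
  either effect gives the minus sign of the second term.\<close>

lemma d_Cons:
  assumes "alt_form \<omega>" "V \<in> S"
  shows "d \<omega> (V # Vs) x = L V \<omega> Vs x - d (ip V \<omega>) Vs x"
proof (cases "set Vs \<subseteq> S")
  case True
  let ?n = "length Vs"
  \<comment> \<open>The definition of \<open>d\<close> puts brackets in first place, that of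
    \<open>L\<close> in the place of the replaced argument; moving one to the other absorbs
    \<open>(-1) ^ j\<close>.\<close>
  have front: "(-1) ^ j * \<omega> (X # omit j Vs) x = \<omega> (Vs[j := X]) x" if "j < ?n" for j X
    using that alt_move[OF assms(1), of "take j Vs" X "drop (Suc j) Vs" x]
    by (simp add: upd_conv_take_nth_drop omit_def)
  have "d \<omega> (V # Vs) x =
      (\<Sum>i<Suc ?n. (-1) ^ i * D ((V # Vs) ! i) (\<omega> (omit i (V # Vs))) x) +
      (\<Sum>j<Suc ?n. \<Sum>i<j. (-1) ^ (i + j) *
        \<omega> (br ((V # Vs) ! i) ((V # Vs) ! j) # omit i (omit j (V # Vs))) x)"
    using True assms(2) by (simp add: ext_derivative_def del: sum.lessThan_Suc)
  also have "(\<Sum>i<Suc ?n. (-1) ^ i * D ((V # Vs) ! i) (\<omega> (omit i (V # Vs))) x) =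
      D V (\<omega> Vs) x - (\<Sum>i<?n. (-1) ^ i * D (Vs ! i) (ip V \<omega> (omit i Vs)) x)"
    by (simp add: sum.lessThan_Suc_shift omit_Cons interior_product_def sum_negf del: sum.lessThan_Suc)
  \<comment> \<open>The outer index 0 has no pairs; for each later one the pair with
    \<open>i = 0\<close> is split off. Shifting both indices of a remaining pair leaves its sign
    unchanged.\<close>
  also have "(\<Sum>j<Suc ?n. \<Sum>i<j. (-1) ^ (i + j) *
        \<omega> (br ((V # Vs) ! i) ((V # Vs) ! j) # omit i (omit j (V # Vs))) x) =
      (\<Sum>j<?n. - ((-1) ^ j * \<omega> (br V (Vs ! j) # omit j Vs) x) +
        (\<Sum>i<j. (-1) ^ (i + j) * \<omega> (br (Vs ! i) (Vs ! j) # V # omit i (omit j Vs)) x))"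
    by (simp add: sum.lessThan_Suc_shift omit_Cons del: sum.lessThan_Suc)
  also have "\<dots> = (\<Sum>j<?n. - \<omega> (Vs[j := br V (Vs ! j)]) x) -
      (\<Sum>j<?n. \<Sum>i<j. (-1) ^ (i + j) * ip V \<omega> (br (Vs ! i) (Vs ! j) # omit i (omit j Vs)) x)"
    by (simp add: front sum.distrib interior_product_def alt_swap_head[OF assms(1), of _ V]
        sum_negf sum_subtractf)
  finally show ?thesis
    unfolding lie_derivative_def ext_derivative_def if_P[OF True] sum_negf by linarith
next
  case False
  then show ?thesis by (simp add: L_zero d_zero)
qed

lemma ip_d:
  "alt_form \<omega> \<Longrightarrow> V \<in> S \<Longrightarrow> ip V (d \<omega>) = form_add (L V \<omega>) (form_scale (-1) (d (ip V \<omega>)))"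
  by (simp add: fun_eq_iff form_add_def form_scale_def d_Cons interior_product_def[of V "d \<omega>"])

lemma d_add:
  assumes "alt_form \<eta>" "alt_form \<zeta>"
  shows "d (form_add \<eta> \<zeta>) Vs x = d \<eta> Vs x + d \<zeta> Vs x"
proof (cases "set Vs \<subseteq> S")
  case True
  then have "Vs ! i \<in> S" if "i < length Vs" for i
    using that nth_mem by blast
  with assms True show ?thesis
    by (simp add: ext_derivative_def form_add_def D_add alt_smooth[OF assms(1)] alt_smooth[OF assms(2)] sum.distrib distrib_left)
qed (simp add: d_zero)

lemma d_scale:
  assumes "alt_form \<eta>"
  shows "d (form_scale c \<eta>) Vs x = c * d \<eta> Vs x"
proof (cases "set Vs \<subseteq> S")
  case True
  then have "Vs ! i \<in> S" if "i < length Vs" for i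
    using that nth_mem by blast
  with assms True show ?thesis
    by (simp add: ext_derivative_def form_scale_def D_scale alt_smooth[OF assms] sum_distrib_left
        distrib_left mult.left_commute)
qed (simp add: d_zero)

text \<open>Skew-symmetry comes first, because linearity in the head depends on it: exchanging the
  head with the next section \<open>b\<close> and applying Cartan's formula to \<open>b\<close>
  leaves the head as an argument of \<open>L b \<omega>\<close> and of
  \<open>d (ip b \<omega>)\<close>. The recursion ends with a single argument, where linearity is
  that of the anchor.\<close>

lemma alt_d:
  assumes "alt_form \<omega>"
  shows "alt_form (d \<omega>)"
proof -
  have swap: "d \<omega> (Us @ a # b # Vs) x = - d \<omega> (Us @ b # a # Vs) x"
    if "alt_form \<omega>" "set (Us @ a # b # Vs) \<subseteq> S" for \<omega> Us a b Vs x
    using that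
  proof (induction Us arbitrary: \<omega>)
    case Nil
    then have ab: "a \<in> S" "b \<in> S" by auto
    \<comment> \<open>Two uses of Cartan's formula give an expression that is antisymmetric in
      \<open>a\<close> and \<open>b\<close>: the Lie derivative terms change places, and the other
      two change sign.\<close>
    have expand: "d \<omega> (a # b # Vs) x = L a (ip b \<omega>) Vs x - \<omega> (br a b # Vs) x - L b (ip a \<omega>) Vs x
        + d (ip b (ip a \<omega>)) Vs x" if "a \<in> S" "b \<in> S" for a b
      using that Nil(1) by (simp add: d_Cons L_Cons alt_ip)
    have "d (ip b (ip a \<omega>)) Vs x = - d (ip a (ip b \<omega>)) Vs x"
      using Nil(1) by (simp add: ip_swap[of \<omega> b a] d_scale alt_ip)
    then show ?case
      using alt_br_anti[OF Nil(1) ab, of Vs x] by (simp add: expand ab)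
  next
    case (Cons c Us)
    then show ?case
      using alt_swap[OF alt_L[OF _ Cons.prems(1)], of c Us a b Vs x] by (simp add: d_Cons alt_ip)
  qed
  show ?thesis
  proof (rule alt_formI)
    show "d \<omega> Vs = (\<lambda>x. 0)" if "\<not> set Vs \<subseteq> S" for Vs
      using d_zero[OF that] by blast
    show "d \<omega> Vs \<in> C" if Vs: "set Vs \<subseteq> S" for Vs
    proof -
      have "Vs ! i \<in> S" if "i < length Vs" for i
        using that Vs nth_mem by blast
      then show ?thesis
        using Vs assms unfolding ext_derivative_def
        by (simp, intro smooth_add smooth_sum smooth_mult[OF smooth_const])
          (simp_all add: D_smooth alt_smooth[OF assms])
    qed
    show "d \<omega> (sec_add E s t # Vs) x = d \<omega> (s # Vs) x + d \<omega> (t # Vs) x"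
      if st: "s \<in> S" "t \<in> S" and "set Vs \<subseteq> S" for s t Vs x
      using assms that(3)
    proof (induction Vs arbitrary: \<omega>)
      case Nil
      then show ?case
        using st by (simp add: d_Cons d_Nil L_Nil sec_add_in D_sec_add)
    next
      case (Cons b Vs)
      then have head: "d \<omega> (U # b # Vs) x = - (L b \<omega> (U # Vs) x - d (ip b \<omega>) (U # Vs) x)"
        if "U \<in> S" for U
        using swap[of \<omega> "[]" U b Vs x] that by (simp add: d_Cons)
      show ?case
        using Cons st by (simp add: head sec_add_in alt_ip alt_add[OF alt_L[OF _ Cons.prems(1)]] alt_L)
    qed
    show "d \<omega> (sec_scale E f s # Vs) x = f x * d \<omega> (s # Vs) x"
      if fs: "f \<in> C" "s \<in> S" and "set Vs \<subseteq> S" for f s Vs x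
      using assms that(3)
    proof (induction Vs arbitrary: \<omega>)
      case Nil
      then show ?case
        using fs by (simp add: d_Cons d_Nil L_Nil sec_scale_in D_sec_scale)
    next
      case (Cons b Vs)
      then have head: "d \<omega> (U # b # Vs) x = - (L b \<omega> (U # Vs) x - d (ip b \<omega>) (U # Vs) x)"
        if "U \<in> S" for U
        using swap[of \<omega> "[]" U b Vs x] that by (simp add: d_Cons)
      show ?case
        using Cons fs by (simp add: head sec_scale_in alt_ip alt_scale[OF alt_L[OF _ Cons.prems(1)]] alt_L algebra_simps)
    qed
  qed (rule swap[OF assms])
qed

text \<open>Contracting both sides with \<open>U\<close> yields the same term in
  \<open>ip (br V U) \<omega>\<close>. The Lie derivatives of \<omega> itself match by
  \<open>L_br\<close>, and what remains is the claim for \<open>ip U \<omega>\<close>.\<close>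

lemma L_d_commute:
  assumes "V \<in> S" "alt_form \<omega>"
  shows "L V (d \<omega>) Vs x = d (L V \<omega>) Vs x"
  using assms(2)
proof (induction Vs arbitrary: \<omega>)
  case Nil
  have "d \<omega> [] = (\<lambda>x. 0)"
    by (simp add: d_Nil fun_eq_iff)
  then show ?case
    using assms(1) by (simp add: L_Nil d_Nil D_zero)
next
  case (Cons U Vs)
  show ?case
  proof (cases "U \<in> S")
    case True
    note simps = assms(1) True Cons.prems alt_L alt_d alt_ip br_in alt_form_scale
    have "L V (d \<omega>) (U # Vs) x = L V (L U \<omega>) Vs x - L V (d (ip U \<omega>)) Vs x
        - (L (br V U) \<omega> Vs x - d (ip (br V U) \<omega>) Vs x)"
      by (simp add: L_Cons d_Cons ip_d L_add L_scale simps)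
    moreover have "d (L V \<omega>) (U # Vs) x = L U (L V \<omega>) Vs x
        - (d (L V (ip U \<omega>)) Vs x - d (ip (br V U) \<omega>) Vs x)"
      by (simp add: d_Cons ip_L d_add d_scale simps)
    ultimately show ?thesis
      using Cons.IH[OF alt_ip[OF Cons.prems], of U] by (simp add: L_br simps)
  qed (simp add: L_zero d_zero)
qed

text \<open>By Cartan's formula used twice, contraction with \<open>U\<close> commutes with the
  square of \<open>d\<close>, since the two terms with \<open>L U\<close> cancel by
  \<open>L_d_commute\<close>.\<close>

lemma d_d: "alt_form \<omega> \<Longrightarrow> d (d \<omega>) Vs x = 0"
proof (induction Vs arbitrary: \<omega>)
  case (Cons U Vs)
  show ?case
  proof (cases "U \<in> S")
    case True
    then show ?thesis
      using Cons by (simp add: d_Cons alt_d alt_L alt_ip alt_form_scale ip_d d_add d_scale L_d_commute)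
  qed (simp add: d_zero)
qed (simp add: d_Nil)

subsection \<open>Derivation rules\<close>

lemma wedge_zero:
  assumes "alt_form \<eta>" "alt_form \<zeta>" "\<not> set Vs \<subseteq> S"
  shows "wedge \<eta> \<zeta> Vs x = 0"
  using assms
proof (induction Vs arbitrary: \<eta> \<zeta>)
  case (Cons V Vs)
  show ?case
  proof (cases "V \<in> S")
    case True
    then show ?thesis
      using Cons by (simp add: wedge_Cons alt_ip alt_form_hat)
  next
    case False
    then show ?thesis
      using Cons.prems by (simp add: wedge_Cons ip_zero) (simp add: wedge_def)
  qed
qed simp

lemma alt_wedge:
  assumes "alt_form \<eta>" "alt_form \<zeta>"
  shows "alt_form (wedge \<eta> \<zeta>)"
proof (rule alt_formI)
  show "wedge \<eta> \<zeta> Vs = (\<lambda>x. 0)" if "\<not> set Vs \<subseteq> S" for Vs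
    using wedge_zero[OF assms that] by blast
  show "wedge \<eta> \<zeta> Vs \<in> C" for Vs
    unfolding wedge_def Let_def
    by (intro smooth_sum smooth_mult smooth_const alt_smooth[OF assms(1)] alt_smooth[OF assms(2)])
  show "wedge \<eta> \<zeta> (sec_add E s t # Vs) x = wedge \<eta> \<zeta> (s # Vs) x + wedge \<eta> \<zeta> (t # Vs) x"
    if "s \<in> S" "t \<in> S" for s t Vs x
    using that assms by (simp add: wedge_Cons ip_sec_add wedge_bilinear)
  show "wedge \<eta> \<zeta> (sec_scale E f s # Vs) x = f x * wedge \<eta> \<zeta> (s # Vs) x"
    if "f \<in> C" "s \<in> S" for f s Vs x
    using that assms
    by (simp add: wedge_Cons ip_sec_scale wedge_mult_left wedge_mult_right distrib_left)
  show "wedge \<eta> \<zeta> (Us @ a # b # Vs) x = - wedge \<eta> \<zeta> (Us @ b # a # Vs) x" for Us a b Vs x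
    using assms
  proof (induction Us arbitrary: \<eta> \<zeta>)
    case Nil
    \<comment> \<open>The cross terms, one contraction on each factor, change sign under the
      exchange because \<open>form_hat\<close> anticommutes with contraction; the double
      contractions do so by \<open>ip_swap\<close>.\<close>
    then show ?case
      using ip_swap[OF Nil(1), of b a] ip_swap[OF Nil(2), of b a]
      by (simp add: wedge_Cons form_hat_simps wedge_bilinear)
  next
    case (Cons c Us)
    then show ?case
      by (simp add: wedge_Cons alt_ip alt_form_hat)
  qed
qed

text \<open>No sign arises because \<open>L V\<close> has degree 0: it commutes with
  \<open>form_hat\<close>, so both contracted products fall under the induction hypothesis.\<close>

lemma L_wedge:
  assumes "V \<in> S" "alt_form \<eta>" "alt_form \<zeta>"
  shows "L V (wedge \<eta> \<zeta>) Vs x = wedge (L V \<eta>) \<zeta> Vs x + wedge \<eta> (L V \<zeta>) Vs x"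
  using assms(2,3)
proof (induction Vs arbitrary: \<eta> \<zeta>)
  case Nil
  then show ?case
    using assms(1)
    by (simp add: L_Nil wedge_Nil D_mult alt_smooth[OF Nil(1)] alt_smooth[OF Nil(2)] mult.commute)
next
  case (Cons U Vs)
  show ?case
  proof (cases "U \<in> S")
    case True
    note simps = assms(1) True Cons.prems alt_L alt_ip alt_wedge alt_form_hat br_in
    show ?thesis
      by (simp add: simps L_Cons interior_product_wedge L_add Cons.IH wedge_Cons ip_L wedge_bilinear L_hat)
  next
    case False
    then show ?thesis
      using assms(1) Cons.prems by (simp add: L_zero wedge_zero alt_L)
  qed
qed

text \<open>The minus sign reflects that \<open>d\<close> raises the degree by one.\<close>

lemma d_hat: "alt_form \<eta> \<Longrightarrow> d (form_hat \<eta>) Vs x = - form_hat (d \<eta>) Vs x"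
proof (induction Vs arbitrary: \<eta>)
  case Nil
  then show ?case
    by (simp add: d_Nil form_hat_def)
next
  case (Cons U Vs)
  show ?case
  proof (cases "U \<in> S")
    case True
    then have "d (form_hat \<eta>) (U # Vs) x = form_hat (L U \<eta>) Vs x - form_hat (d (ip U \<eta>)) Vs x"
      using Cons
      by (simp add: d_Cons alt_form_hat L_hat form_hat_simps d_scale alt_ip)
    also have "\<dots> = - form_hat (d \<eta>) (U # Vs) x"
      using Cons.prems True by (simp add: form_hat_def d_Cons algebra_simps)
    finally show ?thesis .
  next
    case False
    then show ?thesis
      by (simp add: d_zero form_hat_def)
  qed
qed

lemma d_wedge:
  assumes "alt_form \<eta>" "alt_form \<zeta>"
  shows "d (wedge \<eta> \<zeta>) Vs x = wedge (d \<eta>) \<zeta> Vs x + wedge (form_hat \<eta>) (d \<zeta>) Vs x"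
  using assms
proof (induction Vs arbitrary: \<eta> \<zeta>)
  case Nil
  then show ?case
    by (simp add: d_Nil wedge_Nil)
next
  case (Cons U Vs)
  show ?case
  proof (cases "U \<in> S")
    case True
    note simps = True Cons.prems alt_d alt_L alt_ip alt_wedge alt_form_hat
    \<comment> \<open>The left side yields the derivative of \<open>form_hat \<eta>\<close>, from
      the induction hypothesis for the second contracted product, while the right side yields
      \<open>form_hat\<close> of the derivative; this rewriting makes them equal.\<close>
    have hat: "form_hat (d \<eta>) = form_scale (-1) (d (form_hat \<eta>))"
      by (simp add: fun_eq_iff form_scale_def d_hat Cons.prems)
    show ?thesis
      by (simp add: simps d_Cons interior_product_wedge d_add Cons.IH L_wedge wedge_Cons ip_d hat
          wedge_bilinear form_hat_simps)
  next
    case False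
    then show ?thesis
      using Cons.prems by (simp add: d_zero wedge_zero alt_d alt_form_hat)
  qed
qed

subsection \<open>Homogeneous components\<close>

lemma forms_deg_alt_form:
  assumes "\<omega> \<in> forms_deg A E p"
  shows "alt_form \<omega>"
proof -
  have zero: "\<forall>Vs. \<not> (int (length Vs) = p \<and> set Vs \<subseteq> S) \<longrightarrow> \<omega> Vs = (\<lambda>x. 0)"
    and smooth: "\<forall>Vs. \<omega> Vs \<in> C"
    and add: "\<forall>Vs. \<forall>i<length Vs. set Vs \<subseteq> S \<longrightarrow> (\<forall>s\<in>S. \<forall>t\<in>S.
      \<omega> (Vs[i := sec_add E s t]) = (\<lambda>x. \<omega> (Vs[i := s]) x + \<omega> (Vs[i := t]) x))"
    and scale: "\<forall>Vs. \<forall>i<length Vs. set Vs \<subseteq> S \<longrightarrow> (\<forall>f\<in>C. \<forall>s\<in>S.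
      \<omega> (Vs[i := sec_scale E f s]) = (\<lambda>x. f x * \<omega> (Vs[i := s]) x))"
    and swap: "\<forall>Vs. \<forall>i<length Vs. \<forall>j<length Vs. i \<noteq> j \<longrightarrow>
      \<omega> (Vs[i := Vs ! j, j := Vs ! i]) = (\<lambda>x. - \<omega> Vs x)"
    using assms unfolding forms_deg_def Let_def mem_Collect_eq by - (elim conjE, assumption)+
  show ?thesis
  proof (rule alt_formI)
    show "\<omega> Vs = (\<lambda>x. 0)" if "\<not> set Vs \<subseteq> S" for Vs
      using that by (intro zero[rule_format]) simp
    show "\<omega> (sec_add E s t # Vs) x = \<omega> (s # Vs) x + \<omega> (t # Vs) x"
      if "s \<in> S" "t \<in> S" "set Vs \<subseteq> S" for s t Vs x
      using add[rule_format, of 0 "s # Vs" s t] that by simp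
    show "\<omega> (sec_scale E f s # Vs) x = f x * \<omega> (s # Vs) x"
      if "f \<in> C" "s \<in> S" "set Vs \<subseteq> S" for f s Vs x
      using scale[rule_format, of 0 "s # Vs" f s] that by simp
    show "\<omega> (Us @ a # b # Vs) x = - \<omega> (Us @ b # a # Vs) x" for Us a b Vs x
      using swap[rule_format, of "length Us" "Us @ a # b # Vs" "Suc (length Us)"]
      by (simp add: nth_append list_update_append)
  qed (rule smooth[rule_format])
qed

text \<open>Linearity in every entry and arbitrary exchanges follow from the first entry and
  adjacent exchanges; apart from that, homogeneity is a condition on lengths only.\<close>

lemma forms_deg_iff:
  "\<omega> \<in> forms_deg A E p \<longleftrightarrow> alt_form \<omega> \<and> (\<forall>Vs. int (length Vs) \<noteq> p \<longrightarrow> \<omega> Vs = (\<lambda>x. 0))"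
proof (intro iffI conjI)
  assume \<omega>: "\<omega> \<in> forms_deg A E p"
  then show "alt_form \<omega>"
    by (rule forms_deg_alt_form)
  show "\<forall>Vs. int (length Vs) \<noteq> p \<longrightarrow> \<omega> Vs = (\<lambda>x. 0)"
    using \<omega> by (simp add: forms_deg_def Let_def)
next
  assume "alt_form \<omega> \<and> (\<forall>Vs. int (length Vs) \<noteq> p \<longrightarrow> \<omega> Vs = (\<lambda>x. 0))"
  then have \<omega>: "alt_form \<omega>" and deg: "\<And>Vs. int (length Vs) \<noteq> p \<Longrightarrow> \<omega> Vs = (\<lambda>x. 0)"
    by blast+
  \<comment> \<open>The sign and the remaining list do not depend on \<open>s\<close>, so linearity
    in entry \<open>i\<close> is linearity in the first entry.\<close>
  have update: "\<omega> (Vs[i := s]) x = (-1) ^ i * \<omega> (s # take i Vs @ drop (Suc i) Vs) x"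
    if "i < length Vs" for Vs i s x
    using that alt_move[OF \<omega>, of "take i Vs" s "drop (Suc i) Vs" x]
    by (simp add: upd_conv_take_nth_drop)
  have swap_less: "\<omega> (Vs[i := Vs ! j, j := Vs ! i]) x = - \<omega> Vs x"
    if "i < j" "j < length Vs" for Vs i j x
  proof -
    define Us a Ws b Zs where "Us = take i Vs" and "a = Vs ! i" and "Ws = take (j - Suc i) (drop (Suc i) Vs)"
      and "b = Vs ! j" and "Zs = drop (Suc j) Vs"
    have "drop (Suc i) Vs = Ws @ b # Zs"
      using that id_take_nth_drop[of "j - Suc i" "drop (Suc i) Vs"]
      by (simp add: Ws_def b_def Zs_def)
    then have Vs: "Vs = Us @ a # Ws @ b # Zs"
      using that id_take_nth_drop[of i Vs] by (simp add: Us_def a_def)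
    have len: "length Us = i" "length Ws = j - Suc i"
      using that by (simp_all add: Us_def Ws_def)
    have "j - length Us = Suc (length Ws)" "\<not> j < length Us"
      using that len by simp_all
    then have "Vs[i := b, j := a] = Us @ b # Ws @ a # Zs"
      using len by (subst Vs) (simp add: list_update_append)
    then show ?thesis
      using alt_swap_distant[OF \<omega>, of Us b Ws a Zs x] Vs unfolding a_def b_def by simp
  qed
  have swap: "\<omega> (Vs[i := Vs ! j, j := Vs ! i]) x = - \<omega> Vs x"
    if "i < length Vs" "j < length Vs" "i \<noteq> j" for Vs i j x
  proof (cases "i < j")
    case True
    then show ?thesis using swap_less that by blast
  next
    case False
    then show ?thesis
      using swap_less[of j i Vs x] that by (simp add: list_update_swap)
  qed
  show "\<omega> \<in> forms_deg A E p"
    unfolding forms_deg_def Let_def mem_Collect_eq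
  proof (intro conjI allI impI ballI ext)
    show "\<omega> Vs x = 0" if "\<not> (int (length Vs) = p \<and> set Vs \<subseteq> S)" for Vs x
      using that deg[of Vs] alt_zero[OF \<omega>, of Vs]
      by (cases "int (length Vs) = p") simp_all
    show "\<omega> (Vs[i := Vs ! j, j := Vs ! i]) x = - \<omega> Vs x"
      if "i < length Vs" "j < length Vs" "i \<noteq> j" for Vs i j x
      using that by (rule swap)
  qed (simp_all add: update alt_smooth[OF \<omega>] alt_add[OF \<omega>] alt_scale[OF \<omega>]
      distrib_left mult.left_commute)
qed

lemma deg_part_alt_form:
  assumes "alt_form \<omega>"
  shows "alt_form (deg_part p \<omega>)"
proof (rule alt_formI)
  show "deg_part p \<omega> Vs \<in> C" for Vs
    using alt_smooth[OF assms, of Vs] smooth_const[of 0]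
    by (cases "int (length Vs) = p") (simp_all add: deg_part_def)
  show "deg_part p \<omega> (Us @ a # b # Vs) x = - deg_part p \<omega> (Us @ b # a # Vs) x" for Us a b Vs x
    using alt_swap[OF assms, of Us a b Vs x] by (simp add: deg_part_def)
  show "deg_part p \<omega> Vs = (\<lambda>x. 0)" if "\<not> set Vs \<subseteq> S" for Vs
    using alt_zero[OF assms that] by (auto simp: deg_part_def)
qed (simp_all add: deg_part_def alt_add[OF assms] alt_scale[OF assms])

lemma alt_form_of_deg_parts:
  assumes "\<And>p. alt_form (deg_part p \<omega>)"
  shows "alt_form \<omega>"
proof (rule alt_formI)
  show "\<omega> Vs = (\<lambda>x. 0)" if "\<not> set Vs \<subseteq> S" for Vs
    using alt_zero[OF assms[of "int (length Vs)"] that] by (simp add: deg_part_def)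
  show "\<omega> Vs \<in> C" for Vs
    using alt_smooth[OF assms[of "int (length Vs)"], of Vs] by (simp add: deg_part_def)
  show "\<omega> (sec_add E s t # Vs) x = \<omega> (s # Vs) x + \<omega> (t # Vs) x"
    if "s \<in> S" "t \<in> S" for s t Vs x
    using alt_add[OF assms[of "int (length (s # Vs))"] that, of Vs x] by (simp add: deg_part_def)
  show "\<omega> (sec_scale E f s # Vs) x = f x * \<omega> (s # Vs) x"
    if "f \<in> C" "s \<in> S" for f s Vs x
    using alt_scale[OF assms[of "int (length (s # Vs))"] that, of Vs x] by (simp add: deg_part_def)
  show "\<omega> (Us @ a # b # Vs) x = - \<omega> (Us @ b # a # Vs) x" for Us a b Vs x
    using alt_swap[OF assms[of "int (length (Us @ a # b # Vs))"], of Us a b Vs x]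
    by (simp add: deg_part_def)
qed

text \<open>As degrees are lengths of argument lists, having finitely many nonzero components means
  vanishing on all sufficiently long lists.\<close>

lemma forms_iff:
  "\<omega> \<in> forms A E \<longleftrightarrow> alt_form \<omega> \<and> (\<exists>N. \<forall>Vs. length Vs > N \<longrightarrow> \<omega> Vs = (\<lambda>x. 0))"
proof -
  have "(\<forall>p. deg_part p \<omega> \<in> forms_deg A E p) \<longleftrightarrow> alt_form \<omega>"
  proof
    assume "\<forall>p. deg_part p \<omega> \<in> forms_deg A E p"
    then show "alt_form \<omega>"
      using alt_form_of_deg_parts forms_deg_alt_form by blast
  next
    assume "alt_form \<omega>"
    then show "\<forall>p. deg_part p \<omega> \<in> forms_deg A E p"
      by (simp add: forms_deg_iff deg_part_alt_form) (simp add: deg_part_def)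
  qed
  moreover have "finite {p. deg_part p \<omega> \<noteq> (\<lambda>Vs x. 0)} \<longleftrightarrow>
      (\<exists>N. \<forall>Vs. length Vs > N \<longrightarrow> \<omega> Vs = (\<lambda>x. 0))" (is "finite ?P \<longleftrightarrow> ?bounded")
  proof
    assume fin: "finite ?P"
    have mem: "int (length Vs) \<in> ?P" if "\<omega> Vs \<noteq> (\<lambda>x. 0)" for Vs
    proof -
      have "deg_part (int (length Vs)) \<omega> Vs = \<omega> Vs"
        by (simp add: deg_part_def)
      then show ?thesis
        using that by (auto dest: fun_cong)
    qed
    \<comment> \<open>Inserting 0 keeps the maximum defined when no component is nonzero.\<close>
    have "\<omega> Vs = (\<lambda>x. 0)" if "length Vs > nat (Max (insert 0 ?P))" for Vs
    proof (rule ccontr)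
      assume "\<omega> Vs \<noteq> (\<lambda>x. 0)"
      then have "int (length Vs) \<le> Max (insert 0 ?P)"
        using mem fin by (intro Max_ge) auto
      with that show False by linarith
    qed
    then show ?bounded by blast
  next
    assume ?bounded
    then obtain N where N: "\<And>Vs. length Vs > N \<Longrightarrow> \<omega> Vs = (\<lambda>x. 0)" by blast
    have "?P \<subseteq> {0..int N}"
    proof
      fix p assume "p \<in> ?P"
      then obtain Vs x where "deg_part p \<omega> Vs x \<noteq> 0"
        by (auto simp: fun_eq_iff)
      then have "int (length Vs) = p" "\<omega> Vs x \<noteq> 0"
        by (auto simp: deg_part_def split: if_splits)
      then show "p \<in> {0..int N}"
        using N[of Vs] by (cases "length Vs > N") auto
    qed
    then show "finite ?P"
      by (rule finite_subset) simp
  qed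
  ultimately show ?thesis
    by (simp add: forms_def)
qed

lemma forms_alt_form: "\<omega> \<in> forms A E \<Longrightarrow> alt_form \<omega>"
  by (simp add: forms_iff)

section \<open>The operators on the graded space of forms\<close>

lemma L_vanish:
  assumes "V \<in> S" "\<And>Us. length Us = length Vs \<Longrightarrow> \<omega> Us = (\<lambda>x. 0)"
  shows "L V \<omega> Vs = (\<lambda>x. 0)"
  using assms(1) assms(2)[OF refl]
  by (cases "set Vs \<subseteq> S") (simp_all add: lie_derivative_def assms(2) D_zero)

text \<open>Every term of \<open>d\<close> evaluates the form on a list shorter by one: either an
  argument is omitted, or two are replaced by their bracket. This gives both the degree of
  \<open>d\<close> and its bound on lengths.\<close>

lemma d_vanish:
  assumes "\<And>Us. Suc (length Us) = length Vs \<Longrightarrow> \<omega> Us = (\<lambda>x. 0)"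
  shows "d \<omega> Vs = (\<lambda>x. 0)"
proof (cases "set Vs \<subseteq> S")
  case True
  have "\<omega> (omit i Vs) = (\<lambda>x. 0)" if "i < length Vs" for i
    using that by (intro assms) (simp add: omit_def)
  moreover have "\<omega> (X # omit i (omit j Vs)) = (\<lambda>x. 0)" if "i < j" "j < length Vs" for X i j
    using that by (intro assms) (simp add: omit_def)
  moreover have "Vs ! i \<in> S" if "i < length Vs" for i
    using that True nth_mem by blast
  ultimately show ?thesis
    using True by (simp add: ext_derivative_def D_zero)
qed (simp add: d_zero fun_eq_iff)

lemma form_endomorphism_L:
  assumes "V \<in> S"
  shows "form_endomorphism A E (L V)"
  unfolding form_endomorphism_def
proof (intro conjI ballI allI ext)
  show "L V \<eta> \<in> forms A E" if \<eta>: "\<eta> \<in> forms A E" for \<eta>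
  proof -
    obtain N where alt: "alt_form \<eta>" and N: "\<forall>Vs. length Vs > N \<longrightarrow> \<eta> Vs = (\<lambda>x. 0)"
      using \<eta> unfolding forms_iff by (elim conjE exE)
    have "\<forall>Vs. length Vs > N \<longrightarrow> L V \<eta> Vs = (\<lambda>x. 0)"
      using N by (intro allI impI L_vanish assms) simp
    with alt_L[OF assms alt] show ?thesis
      unfolding forms_iff by (intro conjI exI)
  qed
qed (simp_all add: L_add L_scale assms forms_alt_form form_add_def[of "L V _"] form_scale_def[of _ "L V _"])

lemma form_endomorphism_d: "form_endomorphism A E d"
  unfolding form_endomorphism_def
proof (intro conjI ballI allI ext)
  show "d \<eta> \<in> forms A E" if \<eta>: "\<eta> \<in> forms A E" for \<eta>
  proof -
    obtain N where alt: "alt_form \<eta>" and N: "\<forall>Vs. length Vs > N \<longrightarrow> \<eta> Vs = (\<lambda>x. 0)"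
      using \<eta> unfolding forms_iff by (elim conjE exE)
    have "\<forall>Vs. length Vs > Suc N \<longrightarrow> d \<eta> Vs = (\<lambda>x. 0)"
      using N by (intro allI impI d_vanish) simp
    with alt_d[OF alt] show ?thesis
      unfolding forms_iff by (intro conjI exI)
  qed
qed (simp_all add: d_add d_scale forms_alt_form form_add_def[of "d _"] form_scale_def[of _ "d _"])

lemma form_endomorphism_ip: "form_endomorphism A E (ip V)"
  unfolding form_endomorphism_def
proof (intro conjI ballI allI)
  show "ip V \<eta> \<in> forms A E" if \<eta>: "\<eta> \<in> forms A E" for \<eta>
  proof -
    obtain N where alt: "alt_form \<eta>" and N: "\<forall>Vs. length Vs > N \<longrightarrow> \<eta> Vs = (\<lambda>x. 0)"
      using \<eta> unfolding forms_iff by (elim conjE exE)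
    have "\<forall>Vs. length Vs > N \<longrightarrow> ip V \<eta> Vs = (\<lambda>x. 0)"
      using N by (simp add: interior_product_def)
    with alt_ip[OF alt] show ?thesis
      unfolding forms_iff by (intro conjI exI)
  qed
qed (simp_all add: interior_product_linear)

lemma d_forms_deg: "\<eta> \<in> forms_deg A E p \<Longrightarrow> d \<eta> \<in> forms_deg A E (p + 1)"
  by (auto simp: forms_deg_iff alt_d intro!: d_vanish)

text \<open>This turns the sign operator back into the scalar of the graded Leibniz rule. For
  negative \<open>p\<close> both sides are 0, as no list has that length.\<close>

lemma forms_deg_hat: "\<eta> \<in> forms_deg A E p \<Longrightarrow> form_hat \<eta> = form_scale ((-1) powi p) \<eta>"
proof (intro ext)
  fix Vs x assume "\<eta> \<in> forms_deg A E p"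
  then show "form_hat \<eta> Vs x = form_scale ((-1) powi p) \<eta> Vs x"
    by (cases "int (length Vs) = p") (auto simp: forms_deg_iff form_hat_def form_scale_def)
qed

end

theorem proposition4p2p3:
  fixes A :: "('m::{t2_space,second_countable_topology}, 'b::real_normed_vector) atlas"
    and E :: "('m, 'e, 'f::real_normed_vector) vbundle"
    and br :: "('m \<Rightarrow> 'e) \<Rightarrow> ('m \<Rightarrow> 'e) \<Rightarrow> 'm \<Rightarrow> 'e"
    and \<rho> :: "'e \<Rightarrow> 'm tangent"
  assumes "lie_algebroid A E br \<rho>"
  defines "d \<equiv> ext_derivative A E br \<rho>"
    and "L \<equiv> lie_derivative A E br \<rho>"
  shows
    "(\<forall>V\<in>smooth_sections A E.
        form_endomorphism A E (L V) \<and> form_endomorphism A E d \<and>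
        form_endomorphism A E (interior_product V) \<and>
        (\<forall>\<eta>\<in>forms A E.
           L V \<eta> = form_add (interior_product V (d \<eta>)) (d (interior_product V \<eta>)))) \<and>
     (\<forall>p. \<forall>\<eta>\<in>forms_deg A E p. d \<eta> \<in> forms_deg A E (p + 1)) \<and>
     (\<forall>p. \<forall>\<eta>\<in>forms_deg A E p. \<forall>\<zeta>\<in>forms A E.
        d (wedge \<eta> \<zeta>) =
          form_add (wedge (d \<eta>) \<zeta>) (form_scale ((-1) powi p) (wedge \<eta> (d \<zeta>)))) \<and>
     (\<forall>V\<in>smooth_sections A E. \<forall>\<eta>\<in>forms A E. L V (d \<eta>) = d (L V \<eta>)) \<and>
     (\<forall>\<eta>\<in>forms A E. d (d \<eta>) = form_zero)"
proof -
  interpret algebroid A E br \<rho>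
    by (rule algebroid.intro) (rule assms(1))
  show ?thesis
    unfolding d_def L_def
  proof (intro conjI ballI allI)
    fix V \<eta> assume V: "V \<in> S" and \<eta>: "\<eta> \<in> forms A E"
    show "lie_derivative A E br \<rho> V \<eta> = form_add (interior_product V (ext_derivative A E br \<rho> \<eta>))
        (ext_derivative A E br \<rho> (interior_product V \<eta>))"
      using V \<eta> by (simp add: ip_d forms_alt_form) (simp add: form_add_def form_scale_def)
    show "lie_derivative A E br \<rho> V (ext_derivative A E br \<rho> \<eta>) =
        ext_derivative A E br \<rho> (lie_derivative A E br \<rho> V \<eta>)"
      using V \<eta> by (intro ext L_d_commute forms_alt_form)
  next
    fix p \<eta> \<zeta> assume \<eta>: "\<eta> \<in> forms_deg A E p" and \<zeta>: "\<zeta> \<in> forms A E"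
    show "ext_derivative A E br \<rho> (wedge \<eta> \<zeta>) = form_add (wedge (ext_derivative A E br \<rho> \<eta>) \<zeta>)
        (form_scale ((-1) powi p) (wedge \<eta> (ext_derivative A E br \<rho> \<zeta>)))"
      using d_wedge[OF forms_deg_alt_form[OF \<eta>] forms_alt_form[OF \<zeta>]]
      by (simp add: fun_eq_iff forms_deg_hat[OF \<eta>] wedge_bilinear form_add_def form_scale_def[of _ "wedge _ _"])
  next
    fix \<eta> assume "\<eta> \<in> forms A E"
    then show "ext_derivative A E br \<rho> (ext_derivative A E br \<rho> \<eta>) = form_zero"
      by (simp add: fun_eq_iff form_zero_def d_d forms_alt_form)
  qed (simp_all add: form_endomorphism_L form_endomorphism_d form_endomorphism_ip d_forms_deg)
qed

end
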